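(* Let $K^n$ ($n\ge 3$) be a finite $n$-dimensional pseudomanifold and let $\vartheta$ be a reflection on $K^n$ with associated subcomplexes $K_+,K_-,K_0$. Let $\gamma,\lambda\in\mathbb{R}$ and let $\kappa>0$ be such that the partition function $Z_{\mathfrak{C}_\kappa}(\gamma,\lambda)$ is positive. Take the volume form $d\mu(\underline{z})=\prod_{\sigma^1\in\Sigma^1(K^n)}dz^{\sigma^1}$. Then for every $f\in C(\mathfrak{C}_{+,\kappa},\mathbb{C})$, $$\langle f,f\rangle_\vee=\frac{1}{Z_{\mathfrak{C}_\kappa}(\gamma,\lambda)}\int_{\mathfrak{C}_\kappa}\overline{f((\vartheta\underline{z})_+)}\,f(\underline{z}_+)\,e^{-H_{\gamma,\lambda}(\underline{z})}\,d\mu(\underline{z})\ \ge 0,$$ i.e. $\langle\cdot,\cdot\rangle_\vee$ is a (possibly degenerate) positive semi-definite scalar product on $C(\mathfrak{C}_{+,\kappa},\mathbb{C})$.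
   Context: A finite simplicial complex is a finite vertex set together with a family of nonempty subsets (simplexes) containing all singletons and closed under passing to nonempty subsets; a $k$-simplex has $k+1$ vertices, 1-simplexes are edges. An $n$-dimensional pseudomanifold $K^n$ is a simplicial complex in which every simplex is a face of some $n$-simplex, every $(n-1)$-simplex is a face of at most two $n$-simplexes, and any two $n$-simplexes are joined by a finite chain of $n$-simplexes with consecutive ones sharing an $(n-1)$-simplex. Its boundary $\partial K^n$ is the subcomplex formed by the $(n-1)$-simplexes lying in exactly one $n$-simplex, together with their faces. $\Sigma^1(K)$ denotes the set of edges of $K$. For a simplex $\sigma$ with vertices labelled $0,1,\dots,k$ and positive numbers $z_{ij}=z_{ji}$ attached to its edges ($z_{ii}=0$), let $A(\underline{z}(\sigma))$ be the $k\times k$ matrix with entries $a_{ij}=\tfrac12(z_{0i}+z_{0j}-z_{ij})$, $1\le i,j\le k$ (its determinant is independent of the labelling). A metric on $K^n$ is a map $\underline{z}:\Sigma^1(K^n)\to\mathbb{R}_+$, $\sigma^1\mapsto z^{\sigma^1}$, with $\det A(\underline{z}(\sigma))>0$ for every simplex $\sigma$ with $1\le\dim\sigma\le n$; then each $\sigma^k$ is realized as a Euclidean simplex with edge lengths $\sqrt{z^{\sigma^1}}$, of volume $|\sigma^k|(\underline{z})=\frac{1}{k!}(\det A(\underline{z}(\sigma^k)))^{1/2}$. The volume is $V(\underline{z})=\sum_{\sigma^n}|\sigma^n|(\underline{z})$. For $\sigma^{n-2}\subset\sigma^n$, with $\mathbf{n}_1,\mathbf{n}_2$ the outward unit normals of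 the two facets of $\sigma^n$ containing $\sigma^{n-2}$ in a Euclidean realization, the dihedral angle is $(\sigma^{n-2},\sigma^n)(\underline{z})=\tfrac12-\tfrac{1}{2\pi}\arccos\langle\mathbf{n}_1,\mathbf{n}_2\rangle$. The Regge curvature is $\mathcal{R}(\underline{z})=\sum_{\sigma^{n-2}\notin\partial K^n}\big(1-\sum_{\sigma^n\supset\sigma^{n-2}}(\sigma^{n-2},\sigma^n)(\underline{z})\big)|\sigma^{n-2}|(\underline{z})+\sum_{\sigma^{n-2}\in\partial K^n}\big(\tfrac12-\sum_{\sigma^n\supset\sigma^{n-2}}(\sigma^{n-2},\sigma^n)(\underline{z})\big)|\sigma^{n-2}|(\underline{z})$, and the Hilbert action is $H_{\gamma,\lambda}=\gamma\mathcal{R}+\lambda V$. A reflection on $K^n$ is an involutive simplicial automorphism $\vartheta\ne\mathrm{id}$ of $K^n$ for which there are subcomplexes $K_+,K_-$ such that: $K_\pm$ are $n$-dimensional pseudomanifolds; $K_-=\vartheta K_+$; $K_0=K_+\cap K_-$ is a nonempty $(n-1)$-dimensional pseudomanifold; $\vartheta$ is the identity on $K_0$; and $K^n$ is the gluing of $K_+$ and $K_-$ along $K_0$ (every simplex of $K^n$ lies in $K_+$ or in $K_-$). $\vartheta$ acts on metrics by $(\vartheta\underline{z})^{\sigma^1}=z^{\vartheta\sigma^1}$. For $\underline{z}$, $\underline{z}_\pm=\pi_\pm\underline{z}$ denotes its restriction to the edges of $K_\pm$ (so $\underline{z}_+\in\mathbb{R}_+^{n_1(K_+)}$, $n_1$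 = number of edges, and $(\vartheta\underline{z})_+$ is the function $\sigma^1\mapsto z^{\vartheta\sigma^1}$ on edges of $K_+$), and $\|\cdot\|$ is the Euclidean norm. The cut-off is $\mathfrak{C}_\kappa=\{\underline{z}:\det A(\underline{z}(\sigma))\ge1/\kappa\text{ for all }\sigma\in K^n,\ 1\le\dim\sigma\le n,\ \max(\|\underline{z}_+\|,\|\underline{z}_-\|)\le\kappa\}$, a compact subset of the space of metrics, and $\mathfrak{C}_{+,\kappa}=\pi_+(\mathfrak{C}_\kappa)$. $C(\mathfrak{C}_{+,\kappa},\mathbb{C})$ is the space of continuous complex functions on $\mathfrak{C}_{+,\kappa}$. The partition function is $Z_{\mathfrak{C}_\kappa}(\gamma,\lambda)=\int_{\mathfrak{C}_\kappa}e^{-H_{\gamma,\lambda}}d\mu$. *)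

theory Defs
  imports "HOL-Analysis.Analysis"
begin

text \<open>A simplicial complex is a family of nonempty finite vertex sets closed under
  passing to nonempty subsets; its vertex set is the union of its simplices
  (which makes all singletons of vertices simplices).  A k-simplex has k+1 vertices.\<close>

definition simplicial_complex :: "'v set set \<Rightarrow> bool" where
  "simplicial_complex K \<longleftrightarrow>
     (\<forall>s\<in>K. s \<noteq> {} \<and> finite s) \<and> (\<forall>s\<in>K. \<forall>t. t \<subseteq> s \<and> t \<noteq> {} \<longrightarrow> t \<in> K)"

definition simplices_dim :: "'v set set \<Rightarrow> nat \<Rightarrow> 'v set set" where
  "simplices_dim K k = {s\<in>K. card s = k + 1}"

definition edges :: "'v set set \<Rightarrow> 'v set set" where
  "edges K = simplices_dim K 1"

definition adjacent_top :: "nat \<Rightarrow> 'v set set \<Rightarrow> 'v set \<Rightarrow> 'v set \<Rightarrow> bool" where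
  "adjacent_top n K s t \<longleftrightarrow> s \<in> simplices_dim K n \<and> t \<in> simplices_dim K n \<and> card (s \<inter> t) = n"

definition pseudomanifold :: "nat \<Rightarrow> 'v set set \<Rightarrow> bool" where
  "pseudomanifold n K \<longleftrightarrow>
     simplicial_complex K \<and> finite (\<Union>K) \<and> simplices_dim K n \<noteq> {} \<and>
     (\<forall>s\<in>K. \<exists>t\<in>simplices_dim K n. s \<subseteq> t) \<and>
     (\<forall>s\<in>simplices_dim K (n - 1). card {t\<in>simplices_dim K n. s \<subseteq> t} \<le> 2) \<and>
     (\<forall>s\<in>simplices_dim K n. \<forall>t\<in>simplices_dim K n. (adjacent_top n K)\<^sup>*\<^sup>* s t)"

definition boundary :: "nat \<Rightarrow> 'v set set \<Rightarrow> 'v set set" where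
  "boundary n K = {t. t \<noteq> {} \<and> (\<exists>s\<in>simplices_dim K (n - 1).
       card {u\<in>simplices_dim K n. s \<subseteq> u} = 1 \<and> t \<subseteq> s)}"

text \<open>A metric assigns to every edge (a 2-element vertex set) the number z (squared length).
  Determinant of the matrix A(z(sigma)) with respect to a chosen base vertex v0, given by
  the Leibniz formula over permutations of the remaining vertices.\<close>

definition zz :: "('v set \<Rightarrow> real) \<Rightarrow> 'v \<Rightarrow> 'v \<Rightarrow> real" where
  "zz z i j = (if i = j then 0 else z {i, j})"

definition detA :: "('v set \<Rightarrow> real) \<Rightarrow> 'v set \<Rightarrow> real" where
  "detA z \<sigma> = (let v0 = (SOME v. v \<in> \<sigma>); S = \<sigma> - {v0};
      a = (\<lambda>i j. (zz z v0 i + zz z v0 j - zz z i j) / 2)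
    in \<Sum>p\<in>{p. p permutes S}. of_int (sign p) * (\<Prod>i\<in>S. a i (p i)))"

definition svol :: "('v set \<Rightarrow> real) \<Rightarrow> 'v set \<Rightarrow> real" where
  "svol z \<sigma> = (1 / fact (card \<sigma> - 1)) * sqrt (detA z \<sigma>)"

definition total_volume :: "nat \<Rightarrow> 'v set set \<Rightarrow> ('v set \<Rightarrow> real) \<Rightarrow> real" where
  "total_volume n K z = (\<Sum>\<sigma>\<in>simplices_dim K n. svol z \<sigma>)"

definition realizes :: "nat \<Rightarrow> ('v set \<Rightarrow> real) \<Rightarrow> 'v set \<Rightarrow> ('v \<Rightarrow> nat \<Rightarrow> real) \<Rightarrow> bool" where
  "realizes n z \<sigma> p \<longleftrightarrow>
     (\<forall>u\<in>\<sigma>. \<forall>w\<in>\<sigma>. u \<noteq> w \<longrightarrow> (\<Sum>i<n. (p u i - p w i)^2) = z {u, w})"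

definition outward_normal :: "nat \<Rightarrow> 'v set \<Rightarrow> ('v \<Rightarrow> nat \<Rightarrow> real) \<Rightarrow> 'v \<Rightarrow> (nat \<Rightarrow> real) \<Rightarrow> bool" where
  "outward_normal n \<sigma> p w \<nu> \<longleftrightarrow>
     (\<Sum>i<n. (\<nu> i)^2) = 1 \<and> (\<forall>i\<ge>n. \<nu> i = 0) \<and>
     (\<forall>a\<in>\<sigma> - {w}. \<forall>b\<in>\<sigma> - {w}. (\<Sum>i<n. \<nu> i * (p a i - p b i)) = 0) \<and>
     (\<forall>a\<in>\<sigma> - {w}. (\<Sum>i<n. \<nu> i * (p w i - p a i)) < 0)"

text \<open>Dihedral angle (normalized, full angle = 1) of the n-simplex sigma at its
  (n-2)-face tau: the two facets containing tau are those opposite the two vertices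
  of sigma - tau.\<close>

definition dihedral :: "nat \<Rightarrow> ('v set \<Rightarrow> real) \<Rightarrow> 'v set \<Rightarrow> 'v set \<Rightarrow> real" where
  "dihedral n z \<tau> \<sigma> = (let ws = \<sigma> - \<tau>;
       w1 = (SOME w. w \<in> ws); w2 = (SOME w. w \<in> ws \<and> w \<noteq> w1);
       p = (SOME p. realizes n z \<sigma> p);
       \<nu>1 = (SOME \<nu>. outward_normal n \<sigma> p w1 \<nu>);
       \<nu>2 = (SOME \<nu>. outward_normal n \<sigma> p w2 \<nu>)
     in 1/2 - arccos (\<Sum>i<n. \<nu>1 i * \<nu>2 i) / (2 * pi))"

definition regge :: "nat \<Rightarrow> 'v set set \<Rightarrow> ('v set \<Rightarrow> real) \<Rightarrow> real" where
  "regge n K z = (\<Sum>\<tau>\<in>simplices_dim K (n - 2).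
      ((if \<tau> \<in> boundary n K then 1/2 else 1)
        - (\<Sum>\<sigma>\<in>{\<sigma>\<in>simplices_dim K n. \<tau> \<subseteq> \<sigma>}. dihedral n z \<tau> \<sigma>)) * svol z \<tau>)"

definition hilbert_action :: "real \<Rightarrow> real \<Rightarrow> nat \<Rightarrow> 'v set set \<Rightarrow> ('v set \<Rightarrow> real) \<Rightarrow> real" where
  "hilbert_action gam lam n K z = gam * regge n K z + lam * total_volume n K z"

definition reflection :: "nat \<Rightarrow> 'v set set \<Rightarrow> ('v \<Rightarrow> 'v) \<Rightarrow> 'v set set \<Rightarrow> 'v set set \<Rightarrow> bool" where
  "reflection n K \<theta> Kp Km \<longleftrightarrow>
     (\<forall>v\<in>\<Union>K. \<theta> v \<in> \<Union>K \<and> \<theta> (\<theta> v) = v) \<and>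
     (\<forall>s\<in>K. \<theta> ` s \<in> K) \<and>
     (\<exists>v\<in>\<Union>K. \<theta> v \<noteq> v) \<and>
     Kp \<subseteq> K \<and> Km \<subseteq> K \<and>
     pseudomanifold n Kp \<and> pseudomanifold n Km \<and>
     Km = (\<lambda>s. \<theta> ` s) ` Kp \<and>
     Kp \<inter> Km \<noteq> {} \<and> pseudomanifold (n - 1) (Kp \<inter> Km) \<and>
     (\<forall>v\<in>\<Union>(Kp \<inter> Km). \<theta> v = v) \<and>
     K = Kp \<union> Km"

definition edge_norm :: "'v set set \<Rightarrow> ('v set \<Rightarrow> real) \<Rightarrow> real" where
  "edge_norm L z = sqrt (\<Sum>e\<in>edges L. (z e)^2)"

definition cutoff :: "nat \<Rightarrow> 'v set set \<Rightarrow> 'v set set \<Rightarrow> 'v set set \<Rightarrow> real \<Rightarrow> ('v set \<Rightarrow> real) set" where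
  "cutoff n K Kp Km \<kappa> = {z \<in> edges K \<rightarrow>\<^sub>E UNIV.
      (\<forall>e\<in>edges K. z e > 0) \<and>
      (\<forall>\<sigma>\<in>K. 2 \<le> card \<sigma> \<and> card \<sigma> \<le> n + 1 \<longrightarrow> detA z \<sigma> \<ge> 1 / \<kappa>) \<and>
      max (edge_norm Kp z) (edge_norm Km z) \<le> \<kappa>}"

definition edge_measure :: "'v set set \<Rightarrow> ('v set \<Rightarrow> real) measure" where
  "edge_measure K = PiM (edges K) (\<lambda>_. lborel)"

definition proj_plus :: "'v set set \<Rightarrow> ('v set \<Rightarrow> real) \<Rightarrow> ('v set \<Rightarrow> real)" where
  "proj_plus Kp z = restrict z (edges Kp)"

definition refl_metric :: "('v \<Rightarrow> 'v) \<Rightarrow> ('v set \<Rightarrow> real) \<Rightarrow> ('v set \<Rightarrow> real)" where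
  "refl_metric \<theta> z = (\<lambda>e. z (\<theta> ` e))"

definition partition_fn :: "real \<Rightarrow> real \<Rightarrow> nat \<Rightarrow> 'v set set \<Rightarrow> 'v set set \<Rightarrow> 'v set set \<Rightarrow> real \<Rightarrow> real" where
  "partition_fn gam lam n K Kp Km \<kappa> =
     (LINT z:cutoff n K Kp Km \<kappa>|edge_measure K. exp (- hilbert_action gam lam n K z))"

end

theory Submission
  imports Defs "Jordan_Normal_Form.Determinant"
begin

text \<open>
  Every simplex lies in \<open>Kp\<close> or \<open>Km\<close>, and \<open>\<theta>\<close> exchanges the two.  Counting a simplex with weight 1, 1/2
  or 0 according to whether it lies in \<open>Kp\<close> only, in both, or in \<open>Km\<close> only, splits the action as
  \<open>H(z) = G(z\<^sub>+) + G((\<theta> z)\<^sub>+)\<close>, and the cut-off factorizes in the same way.  The integrand is therefore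
  \<open>cnj (F ((\<theta> z)\<^sub>+)) * F (z\<^sub>+)\<close>, and by Fubini the integral over the edges outside \<open>Kp \<inter> Km\<close> is the
  squared modulus of an integral of \<open>F\<close>, for every value of \<open>z\<close> on the edges of \<open>Kp \<inter> Km\<close>.
  Measurability of \<open>F\<close> plays no role, since the Bochner integral of a non-integrable function is 0.

  The splitting rests on the \<open>\<theta>\<close>-equivariance of volumes and dihedral angles, that is, on their
  independence of the base vertices, realizations and normals chosen in their definitions.  On the
  cut-off a realization exists by a Cholesky factorization of the Gram matrix \<open>A\<close>, and the angles are
  determined by the entries of \<open>A\<^sup>-\<^sup>1\<close>.
\<close>

section \<open>The Gram matrix of a simplex\<close>

text \<open>By polarization, the inner product of the edge vectors from \<open>v\<close> to
  \<open>i\<close> and from \<open>v\<close> to \<open>j\<close> in any Euclidean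
  realization.\<close>

definition gram_entry :: "('v set \<Rightarrow> real) \<Rightarrow> 'v \<Rightarrow> 'v \<Rightarrow> 'v \<Rightarrow> real" where
  "gram_entry z v i j = (zz z v i + zz z v j - zz z i j) / 2"

text \<open>The matrix A at base vertex \<open>v\<close>. The enumeration \<open>h\<close> replaces
  vertices by indices, so that matrix determinants and inverses apply.\<close>

definition gram_mat :: "('v set \<Rightarrow> real) \<Rightarrow> 'v \<Rightarrow> nat \<Rightarrow> (nat \<Rightarrow> 'v) \<Rightarrow> real mat" where
  "gram_mat z v k h = mat k k (\<lambda>(i, j). gram_entry z v (h i) (h j))"

text \<open>Conjugation by \<open>h\<close> maps the permutations of the index set bijectively onto
  those of \<open>S\<close> and preserves signs; this links the Leibniz sum in \<open>detA\<close>
  to matrix determinants.\<close>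

lemma leibniz_reindex:
  fixes a :: "'b \<Rightarrow> 'b \<Rightarrow> 'a::comm_ring_1"
  assumes h: "bij_betw h {0..<k} S"
  shows "(\<Sum>p | p permutes S. of_int (sign p) * (\<Prod>i\<in>S. a i (p i)))
    = Determinant.det (mat k k (\<lambda>(i, j). a (h i) (h j)))"
proof -
  let ?I = "{0..<k}"
  let ?\<Phi> = "\<lambda>\<pi> x. if x \<in> S then h (\<pi> (inv_into ?I h x)) else x"
  have inj: "inj_on h ?I" and im: "h ` ?I = S" using h by (auto simp: bij_betw_def)
  have b: "bij_betw ?\<Phi> {p. p permutes ?I} {p. p permutes S}"
    by (rule bij_betw_permutations[OF h])
  have "(\<Sum>p | p permutes S. of_int (sign p) * (\<Prod>i\<in>S. a i (p i)))
    = (\<Sum>p | p permutes ?I. of_int (sign (?\<Phi> p)) * (\<Prod>i\<in>S. a i (?\<Phi> p i)))"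
    by (rule sum.reindex_bij_betw[OF b, symmetric])
  also have "\<dots> = (\<Sum>p | p permutes ?I. of_int (sign p) * (\<Prod>i\<in>?I. a (h i) (h (p i))))"
  proof (rule sum.cong[OF refl])
    fix p assume "p \<in> {p. p permutes ?I}"
    then have p: "p permutes ?I" by simp
    have "?\<Phi> p = map_permutation ?I h p"
      by (auto simp: map_permutation_def restrict_id_def im fun_eq_iff)
    then have s: "sign (?\<Phi> p) = sign p"
      using sign_map_permutation[OF inj p] by simp
    have "(\<Prod>i\<in>S. a i (?\<Phi> p i)) = (\<Prod>i\<in>?I. a (h i) (?\<Phi> p (h i)))"
      by (rule prod.reindex_bij_betw[OF h, symmetric])
    also have "\<dots> = (\<Prod>i\<in>?I. a (h i) (h (p i)))"
      by (rule prod.cong[OF refl]) (use im inj in \<open>auto simp: inv_into_f_f\<close>)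
    finally show "of_int (sign (?\<Phi> p)) * (\<Prod>i\<in>S. a i (?\<Phi> p i))
      = of_int (sign p) * (\<Prod>i\<in>?I. a (h i) (h (p i)))" by (simp only: s)
  qed
  also have "\<dots> = Determinant.det (mat k k (\<lambda>(i, j). a (h i) (h j)))"
    by (subst det_def'[of _ k], simp, intro sum.cong[OF refl] arg_cong2[where f="(*)"] prod.cong refl)
      (auto simp: permutes_in_image)
  finally show ?thesis .
qed

lemma detA_SOME:
  assumes h: "bij_betw h {0..<k} (\<sigma> - {SOME v. v \<in> \<sigma>})"
  shows "detA z \<sigma> = Determinant.det (gram_mat z (SOME v. v \<in> \<sigma>) k h)"
  unfolding detA_def gram_mat_def Let_def
  by (subst leibniz_reindex[OF h]) (simp add: gram_entry_def)

text \<open>Both determinants equal one Leibniz sum over \<open>S\<close>, in which no enumeration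
  occurs.\<close>

lemma det_gram_mat_reindex:
  assumes h: "bij_betw h {0..<k} S" and h': "bij_betw h' {0..<k} S"
  shows "Determinant.det (gram_mat z v k h) = Determinant.det (gram_mat z v k h')"
  unfolding gram_mat_def
  using leibniz_reindex[OF h, of "gram_entry z v"] leibniz_reindex[OF h', of "gram_entry z v"] by simp

lemma zz_sym: "zz z i j = zz z j i"
  by (simp add: zz_def insert_commute)

lemma zz_self [simp]: "zz z i i = 0"
  by (simp add: zz_def)

text \<open>Passing from the edge vectors at \<open>v\<close> to those at \<open>w = h 0\<close> is the unimodular base change
  \<open>x\<^sub>v - x\<^sub>w = - (x\<^sub>w - x\<^sub>v)\<close>, \<open>x\<^sub>j - x\<^sub>w = (x\<^sub>j - x\<^sub>v) - (x\<^sub>w - x\<^sub>v)\<close>, so the Gram matrix \<open>A\<close> becomes \<open>P A P\<^sup>T\<close>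
  with \<open>det P = -1\<close>.\<close>

lemma det_gram_mat_swap_base:
  assumes k: "0 < k"
  shows "Determinant.det (gram_mat z (h 0) k (h(0 := v))) = Determinant.det (gram_mat z v k h)"
proof -
  let ?A = "gram_mat z v k h"
  define P :: "real mat" where
    "P = mat k k (\<lambda>(i, j). if j = 0 then -1 else if i = j then 1 else 0)"
  have P: "P \<in> carrier_mat k k" by (simp add: P_def)
  have A: "?A \<in> carrier_mat k k" by (simp add: gram_mat_def)
  have PA: "(P * ?A) $$ (i, j) = (if i = 0 then 0 else ?A $$ (i, j)) - ?A $$ (0, j)"
    if "i < k" "j < k" for i j
  proof -
    have "(P * ?A) $$ (i, j) = (\<Sum>l\<in>{0..<k}. P $$ (i, l) * ?A $$ (l, j))"
      using P A that by (simp add: scalar_prod_def)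
    also have "\<dots> = (\<Sum>l\<in>{0..<k}. (if l = i then (if i = 0 then 0 else ?A $$ (i, j)) else 0)
        + (if l = 0 then - ?A $$ (0, j) else 0))"
      by (rule sum.cong) (use that in \<open>auto simp: P_def\<close>)
    also have "\<dots> = (if i = 0 then 0 else ?A $$ (i, j)) - ?A $$ (0, j)"
      using that by (simp add: sum.distrib)
    finally show ?thesis .
  qed
  have PAc: "P * ?A \<in> carrier_mat k k" using P A by simp
  have MP: "(M * P\<^sup>T) $$ (i, j) = (if j = 0 then 0 else M $$ (i, j)) - M $$ (i, 0)"
    if M: "M \<in> carrier_mat k k" and "i < k" "j < k" for M i j
  proof -
    have "(M * P\<^sup>T) $$ (i, j) = (\<Sum>l\<in>{0..<k}. M $$ (i, l) * P $$ (j, l))"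
      using P M that by (simp add: scalar_prod_def)
    also have "\<dots> = (\<Sum>l\<in>{0..<k}. (if l = j then (if j = 0 then 0 else M $$ (i, j)) else 0)
        + (if l = 0 then - M $$ (i, 0) else 0))"
      by (rule sum.cong) (use that in \<open>auto simp: P_def\<close>)
    also have "\<dots> = (if j = 0 then 0 else M $$ (i, j)) - M $$ (i, 0)"
      using that by (simp add: sum.distrib)
    finally show ?thesis .
  qed
  have "gram_mat z (h 0) k (h(0 := v)) = P * ?A * P\<^sup>T"
  proof (rule eq_matI)
    fix i j assume "i < dim_row (P * ?A * P\<^sup>T)" "j < dim_col (P * ?A * P\<^sup>T)"
    then have ij: "i < k" "j < k" using P by auto
    show "gram_mat z (h 0) k (h(0 := v)) $$ (i, j) = (P * ?A * P\<^sup>T) $$ (i, j)"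
      unfolding MP[OF PAc ij] PA[OF ij] PA[OF ij(1) k]
      using ij k by (cases "i = 0"; cases "j = 0")
        (simp_all add: gram_mat_def gram_entry_def zz_self zz_sym field_simps)
  qed (use P in \<open>auto simp: gram_mat_def\<close>)
  moreover have "Determinant.det P = -1"
  proof -
    have "Determinant.det P = prod_list (diag_mat P)"
      by (rule det_lower_triangular[OF _ P]) (auto simp: P_def)
    also have "\<dots> = (\<Prod>i = 0..<k. if i = 0 then -1 else 1)"
      unfolding prod_list_diag_prod by (rule prod.cong) (auto simp: P_def)
    also have "\<dots> = -1" using k by (simp add: prod.If_cases)
    finally show ?thesis .
  qed
  ultimately show ?thesis
    using P A PAc by (simp add: det_mult[of _ k] det_transpose[of _ k])
qed

text \<open>Frees \<open>detA\<close> from the base vertex picked by \<open>SOME\<close>: a base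
  change leads from that vertex to \<open>v\<close>, and enumerations are interchangeable.\<close>

lemma detA_eq_det_gram_mat:
  assumes v: "v \<in> \<sigma>" and h: "bij_betw h {0..<k} (\<sigma> - {v})"
  shows "detA z \<sigma> = Determinant.det (gram_mat z v k h)"
proof (cases "v = (SOME v. v \<in> \<sigma>)")
  case True
  then show ?thesis using detA_SOME[of h k \<sigma> z] h by simp
next
  case False
  define w where "w = (SOME v. v \<in> \<sigma>)"
  have w: "w \<in> \<sigma>" unfolding w_def using v by (metis someI)
  with False have wS: "w \<in> \<sigma> - {v}" by (auto simp: w_def)
  then have "w \<in> h ` {0..<k}"
    using h by (simp add: bij_betw_def)
  then obtain i where i: "i < k" "h i = w" by auto
  then have k: "0 < k" by simp
  \<comment> \<open>The base change exchanges \<open>v\<close> with the vertex at index 0, so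
    \<open>w\<close> is moved there first.\<close>
  define g where "g = h \<circ> Transposition.transpose 0 i"
  have tr: "bij_betw (Transposition.transpose 0 i) {0..<k} {0..<k}"
    using k i by (intro bij_betw_byWitness[where f' = "Transposition.transpose 0 i"])
      (auto simp: Transposition.transpose_def)
  have g: "bij_betw g {0..<k} (\<sigma> - {v})"
    unfolding g_def by (rule bij_betw_trans[OF tr h])
  have g0: "g 0 = w" using i by (simp add: g_def)
  have inj: "inj_on g {0..<k}" and im: "g ` {0..<k} = \<sigma> - {v}"
    using g by (auto simp: bij_betw_def)
  have "bij_betw (g(0 := v)) {0..<k} (\<sigma> - {w})"
  proof (rule bij_betw_imageI)
    show "inj_on (g(0 := v)) {0..<k}"
      using inj im by (intro inj_on_fun_updI) auto
    have "{0..<k} = insert 0 ({0..<k} - {0})" using k by auto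
    moreover have "g ` ({0..<k} - {0}) = \<sigma> - {v} - {w}"
      using inj_on_image_set_diff[OF inj, of "{0..<k}" "{0}"] k im g0 by simp
    ultimately have "g(0 := v) ` {0..<k} = insert v (\<sigma> - {v} - {w})"
      by (metis (no_types, lifting) fun_upd_image insert_iff)
    then show "g(0 := v) ` {0..<k} = \<sigma> - {w}" using v wS by auto
  qed
  then have "detA z \<sigma> = Determinant.det (gram_mat z w k (g(0 := v)))"
    unfolding w_def by (rule detA_SOME)
  also have "\<dots> = Determinant.det (gram_mat z v k g)"
    using det_gram_mat_swap_base[OF k, of z g v] g0 by simp
  also have "\<dots> = Determinant.det (gram_mat z v k h)"
    by (rule det_gram_mat_reindex[OF g h])
  finally show ?thesis .
qed

section \<open>Cholesky factorization\<close>

lemma ex_mat_inverse: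
  fixes A :: "'a::field mat"
  assumes A: "A \<in> carrier_mat n n" and d: "Determinant.det A \<noteq> 0"
  shows "\<exists>B\<in>carrier_mat n n. A * B = 1\<^sub>m n \<and> B * A = 1\<^sub>m n"
  using det_non_zero_imp_unit[OF A d, of "()"]
  by (auto simp: Units_def ring_mat_def)

text \<open>Induction by bordering: the factor \<open>L\<close> of the leading block receives a new
  row made of \<open>l\<close> and \<open>sqrt d\<close>, where \<open>L * l\<close> is the new
  column. Positivity of \<open>d\<close> follows because the next minor equals \<open>d\<close>
  times the square of the determinant of \<open>L\<close>.\<close>

lemma cholesky:
  fixes a :: "nat \<Rightarrow> nat \<Rightarrow> real"
  assumes sym: "\<And>i j. a i j = a j i"
    and minors: "\<And>m. 0 < m \<Longrightarrow> m \<le> k \<Longrightarrow> 0 < Determinant.det (mat m m (\<lambda>(i, j). a i j))"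
  shows "\<exists>L\<in>carrier_mat k k. L * L\<^sup>T = mat k k (\<lambda>(i, j). a i j)"
  using minors
proof (induction k)
  case 0
  show ?case by (rule bexI[of _ "1\<^sub>m 0"]) auto
next
  case (Suc k)
  let ?A = "mat k k (\<lambda>(i, j). a i j)"
  obtain L where L: "L \<in> carrier_mat k k" "L * L\<^sup>T = ?A"
    using Suc by (metis le_SucI)
  \<comment> \<open>For \<open>k = 0\<close> the premise on minors says nothing, but the empty
    determinant is 1.\<close>
  have "0 < Determinant.det ?A" using Suc.prems[of k] by (cases "k = 0") auto
  moreover have dA: "Determinant.det ?A = Determinant.det L * Determinant.det L"
    using det_mult[OF L(1), of "L\<^sup>T"] L by (simp add: det_transpose)
  ultimately have dL: "Determinant.det L \<noteq> 0" by auto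
  obtain L' where L': "L' \<in> carrier_mat k k" "L * L' = 1\<^sub>m k"
    using ex_mat_inverse[OF L(1) dL] by blast
  define b where "b = mat k 1 (\<lambda>(i, j). a i k)"
  define l where "l = L' * b"
  have b: "b \<in> carrier_mat k 1" by (simp add: b_def)
  have l: "l \<in> carrier_mat k 1" using L' b by (simp add: l_def)
  have Ll: "L * l = b" unfolding l_def using L L' b
    by (simp add: assoc_mult_mat[symmetric, of _ k k _ k _ 1])
  have lL: "l\<^sup>T * L\<^sup>T = b\<^sup>T" using transpose_mult[OF L(1) l] Ll by simp
  \<comment> \<open>The Schur complement of the leading block; its sign is not yet known.\<close>
  define d where "d = a k k - (l\<^sup>T * l) $$ (0, 0)"
  \<comment> \<open>\<open>M s\<close> serves twice: \<open>M 1 * N\<close> factors the matrix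
    without a square root and so reveals the sign of \<open>d\<close>; \<open>M (sqrt d)\<close> is
    then the Cholesky factor.\<close>
  define M where "M s = four_block_mat L (0\<^sub>m k 1) (l\<^sup>T) (mat 1 1 (\<lambda>_. s))" for s :: real
  define N where "N = four_block_mat (L\<^sup>T) l (0\<^sub>m 1 k) (mat 1 1 (\<lambda>_. d))"
  have M: "M s \<in> carrier_mat (Suc k) (Suc k)" for s
    using L l by (auto simp: M_def)
  have N: "N \<in> carrier_mat (Suc k) (Suc k)"
    using L l by (auto simp: N_def)
  have A: "mat (Suc k) (Suc k) (\<lambda>(i, j). a i j) = four_block_mat ?A b (b\<^sup>T) (mat 1 1 (\<lambda>_. a k k))"
    by (rule eq_matI) (auto simp: b_def sym less_Suc_eq)
  have corner: "l\<^sup>T * l + mat 1 1 (\<lambda>_. s) * mat 1 1 (\<lambda>_. t) = mat 1 1 (\<lambda>_. a k k)"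
    if "s * t = d" for s t
    using l that by (intro eq_matI) (auto simp: d_def scalar_prod_def)
  have MN: "M 1 * N = mat (Suc k) (Suc k) (\<lambda>(i, j). a i j)"
    unfolding M_def N_def A
    by (subst mult_four_block_mat[of _ k k _ 1 _ 1 _ _ k _ 1])
      (use L l b corner[of 1 d] in \<open>simp_all add: Ll lL\<close>)
  have "Determinant.det (M 1) = Determinant.det L"
    unfolding M_def
    by (subst det_four_block_mat_upper_right_zero[of _ k _ 1]) (use L l in \<open>simp_all add: det_single\<close>)
  moreover have "Determinant.det N = Determinant.det L * d"
    unfolding N_def
    by (subst det_four_block_mat_lower_left_zero[of _ k _ 1])
      (use L l in \<open>simp_all add: det_single det_transpose\<close>)
  ultimately have "Determinant.det L * Determinant.det L * d > 0"
    using Suc.prems[of "Suc k"] det_mult[OF M N, of 1] unfolding MN by simp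
  then have "0 < d" using \<open>0 < Determinant.det ?A\<close> dA by (simp add: zero_less_mult_iff)
  then have d: "sqrt d * sqrt d = d" by simp
  have t1: "(mat 1 1 (\<lambda>_. s))\<^sup>T = mat 1 1 (\<lambda>_. s)" for s :: real
    by (rule eq_matI) auto
  have "M (sqrt d) * (M (sqrt d))\<^sup>T = mat (Suc k) (Suc k) (\<lambda>(i, j). a i j)"
  proof -
    have "(M (sqrt d))\<^sup>T = four_block_mat (L\<^sup>T) l (0\<^sub>m 1 k) (mat 1 1 (\<lambda>_. sqrt d))"
      unfolding M_def using L l
      by (subst transpose_four_block_mat[of _ k k _ 1 _ 1]) (simp_all add: t1 del: One_nat_def)
    then show ?thesis
      unfolding M_def A
      by (simp only:) (subst mult_four_block_mat[of _ k k _ 1 _ 1 _ _ k _ 1],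
        use L l b corner[OF d] in \<open>simp_all add: Ll lL\<close>)
  qed
  then show ?case using M by blast
qed

section \<open>Euclidean realizations\<close>

lemma realizes_iff:
  "realizes n z \<sigma> p \<longleftrightarrow> (\<forall>u\<in>\<sigma>. \<forall>w\<in>\<sigma>. (\<Sum>c<n. (p u c - p w c)^2) = zz z u w)"
  unfolding realizes_def zz_def by (auto; metis (no_types, lifting) cancel_comm_monoid_add_class.diff_cancel power_zero_numeral sum.neutral)

text \<open>The polarization identity, summed over the coordinates.\<close>

lemma realizes_gram:
  assumes p: "realizes n z \<sigma> p" and "v \<in> \<sigma>" "u \<in> \<sigma>" "w \<in> \<sigma>"
  shows "(\<Sum>c<n. (p u c - p v c) * (p w c - p v c)) = gram_entry z v u w"
proof -
  have "(p u c - p v c) * (p w c - p v c)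
      = ((p v c - p u c)^2 + (p v c - p w c)^2 - (p u c - p w c)^2) / 2" for c
    by (simp add: power2_eq_square field_simps)
  then have "(\<Sum>c<n. (p u c - p v c) * (p w c - p v c))
      = ((\<Sum>c<n. (p v c - p u c)^2) + (\<Sum>c<n. (p v c - p w c)^2) - (\<Sum>c<n. (p u c - p w c)^2)) / 2"
    by (simp only: sum.distrib sum_subtractf flip: sum_divide_distrib)
  then show ?thesis
    using assms by (simp add: realizes_iff gram_entry_def)
qed

lemma ex_enumeration:
  assumes "finite \<sigma>" "card \<sigma> = n + 1" "v \<in> \<sigma>"
  obtains h where "bij_betw h {0..<n} (\<sigma> - {v})"
  using ex_bij_betw_nat_finite[of "\<sigma> - {v}"] assms by auto

lemma enumeration_elem:
  assumes h: "bij_betw h {0..<n} (\<sigma> - {v})" and "u \<in> \<sigma>" "u \<noteq> v"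
  obtains i where "i < n" "u = h i"
proof -
  have "u \<in> h ` {0..<n}" using assms by (simp add: bij_betw_def)
  then show ?thesis using that by auto
qed

text \<open>The leading principal minors of the Gram matrix are the values of \<open>detA\<close> on
  the nested faces spanned by \<open>v\<close> and the first \<open>m\<close> enumerated vertices,
  so positivity on faces is what the Cholesky factorization requires.\<close>

lemma ex_realizes:
  assumes fin: "finite \<sigma>" and card: "card \<sigma> = n + 1"
    and pos: "\<And>\<tau>. \<tau> \<subseteq> \<sigma> \<Longrightarrow> 2 \<le> card \<tau> \<Longrightarrow> 0 < detA z \<tau>"
  shows "\<exists>p. realizes n z \<sigma> p"
proof -
  obtain v where v: "v \<in> \<sigma>" using card by fastforce
  obtain h where h: "bij_betw h {0..<n} (\<sigma> - {v})" using ex_enumeration[OF fin card v] .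
  then have inj: "inj_on h {0..<n}" and im: "h ` {0..<n} = \<sigma> - {v}" by (auto simp: bij_betw_def)
  have "0 < Determinant.det (mat m m (\<lambda>(i, j). gram_entry z v (h i) (h j)))"
    if m: "0 < m" "m \<le> n" for m
  proof -
    let ?\<tau> = "insert v (h ` {0..<m})"
    have injm: "inj_on h {0..<m}" by (rule inj_on_subset[OF inj]) (use m in auto)
    have vn: "v \<notin> h ` {0..<m}" and sub: "?\<tau> \<subseteq> \<sigma>" using im m v by fastforce+
    have "bij_betw h {0..<m} (?\<tau> - {v})" using injm vn by (simp add: bij_betw_def)
    then have "detA z ?\<tau> = Determinant.det (gram_mat z v m h)"
      by (intro detA_eq_det_gram_mat) auto
    moreover have "card ?\<tau> = m + 1" using vn card_image[OF injm] by simp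
    ultimately show ?thesis using pos[OF sub] m by (simp add: gram_mat_def)
  qed
  moreover have "gram_entry z v (h i) (h j) = gram_entry z v (h j) (h i)" for i j
    by (simp add: gram_entry_def zz_sym)
  ultimately obtain L where L: "L \<in> carrier_mat n n"
    and LL: "L * L\<^sup>T = mat n n (\<lambda>(i, j). gram_entry z v (h i) (h j))"
    using cholesky[of "\<lambda>i j. gram_entry z v (h i) (h j)" n] by blast
  \<comment> \<open>The vertex \<open>v\<close> sits at the origin and \<open>h i\<close> at row
    \<open>i\<close> of \<open>L\<close>; the rows of \<open>L\<close> have Gram matrix
    \<open>L * L\<^sup>T\<close>.\<close>
  define x where "x u c = (if u = v then 0 else L $$ (inv_into {0..<n} h u, c))" for u c
  have xx: "(\<Sum>c<n. x u c * x w c) = gram_entry z v u w" if uw: "u \<in> \<sigma>" "w \<in> \<sigma>" for u w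
  proof (cases "u = v \<or> w = v")
    case True
    then show ?thesis by (auto simp: x_def gram_entry_def zz_sym)
  next
    case False
    obtain i where i: "i < n" "u = h i" using enumeration_elem[OF h uw(1)] False by blast
    obtain j where j: "j < n" "w = h j" using enumeration_elem[OF h uw(2)] False by blast
    note ij = i(1) j(1) i(2) j(2)
    have x: "x u = (\<lambda>c. L $$ (i, c))" "x w = (\<lambda>c. L $$ (j, c))"
      using False ij inv_into_f_f[OF inj] by (simp_all add: x_def fun_eq_iff)
    have "(\<Sum>c<n. x u c * x w c) = (L * L\<^sup>T) $$ (i, j)"
      unfolding x using ij(1,2) L(1) by (simp add: scalar_prod_def lessThan_atLeast0)
    then show ?thesis using ij by (simp add: LL)
  qed
  have "(\<Sum>c<n. (x u c - x w c)^2) = zz z u w" if "u \<in> \<sigma>" "w \<in> \<sigma>" for u w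
  proof -
    have "(\<Sum>c<n. (x u c - x w c)^2)
      = (\<Sum>c<n. x u c * x u c) + (\<Sum>c<n. x w c * x w c) - 2 * (\<Sum>c<n. x u c * x w c)"
      by (simp add: power2_eq_square algebra_simps sum.distrib sum_subtractf sum_distrib_left)
    then show ?thesis using that by (simp add: xx gram_entry_def field_simps)
  qed
  then show ?thesis unfolding realizes_iff by blast
qed

text \<open>The columns of \<open>Y\<close> form the basis dual to the edge vectors at
  \<open>v\<close>. Column \<open>i\<close> is thus normal to the facet opposite \<open>h i\<close>
  and points towards \<open>h i\<close>, so its negative, normalized, is the outward normal.
  Components from \<open>n\<close> on are pinned to 0, which makes the normal unique as a function
  and leaves \<open>SOME\<close> no freedom.\<close>

lemma outward_normal_iff:
  assumes v: "v \<in> \<sigma>" and h: "bij_betw h {0..<n} (\<sigma> - {v})" and i: "i < n"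
    and Y: "Y \<in> carrier_mat n n"
    and XY: "mat n n (\<lambda>(i, c). p (h i) c - p v c) * Y = 1\<^sub>m n"
  shows "outward_normal n \<sigma> p (h i) \<nu>
    \<longleftrightarrow> \<nu> = (\<lambda>c. if c < n then - Y $$ (c, i) / sqrt (\<Sum>c<n. (Y $$ (c, i))^2) else 0)" (is "_ \<longleftrightarrow> \<nu> = ?N")
proof -
  let ?X = "mat n n (\<lambda>(i, c). p (h i) c - p v c)"
  let ?s = "sqrt (\<Sum>c<n. (Y $$ (c, i))^2)"
  have X: "?X \<in> carrier_mat n n" by simp
  have YX: "Y * ?X = 1\<^sub>m n" by (rule mat_mult_left_right_inverse[OF X Y XY])
  have inj: "inj_on h {0..<n}" and im: "h ` {0..<n} = \<sigma> - {v}" using h by (auto simp: bij_betw_def)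
  have hi: "h i \<in> \<sigma>" "h i \<noteq> v" using i im by auto
  have XYe: "(\<Sum>c<n. (p (h j) c - p v c) * Y $$ (c, i)) = (if j = i then 1 else 0)" if "j < n" for j
  proof -
    have "(?X * Y) $$ (j, i) = (\<Sum>c<n. (p (h j) c - p v c) * Y $$ (c, i))"
      using that i Y by (simp add: scalar_prod_def lessThan_atLeast0)
    then show ?thesis unfolding XY using that i by simp
  qed
  have "(\<Sum>c<n. (Y $$ (c, i))^2) \<noteq> 0"
  proof
    assume "(\<Sum>c<n. (Y $$ (c, i))^2) = 0"
    then have "\<forall>c<n. Y $$ (c, i) = 0" by (simp add: sum_nonneg_eq_0_iff)
    then show False using XYe[OF i] by simp
  qed
  then have spos: "0 < (\<Sum>c<n. (Y $$ (c, i))^2)"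
    by (metis (no_types, lifting) less_eq_real_def sum_nonneg zero_le_power2)
  have s2: "?s * ?s = (\<Sum>c<n. (Y $$ (c, i))^2)" and s0: "0 < ?s" using spos by simp_all
  have cases: "\<exists>j<n. j \<noteq> i \<and> a = h j" if "a \<in> \<sigma> - {h i}" "a \<noteq> v" for a
    using enumeration_elem[OF h, of a] that by blast
  show ?thesis
  proof
    assume N: "outward_normal n \<sigma> p (h i) \<nu>"
    \<comment> \<open>The normal is orthogonal to every edge vector at \<open>v\<close> except the
      one to \<open>h i\<close>; the remaining pairing is \<open>- t\<close>, negative by
      outwardness.\<close>
    define t where "t = - (\<Sum>c<n. \<nu> c * (p (h i) c - p v c))"
    have t: "0 < t" using N v hi unfolding outward_normal_def t_def by auto
    have Xn: "(\<Sum>c<n. \<nu> c * (p (h j) c - p v c)) = (if j = i then - t else 0)" if j: "j < n" for j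
    proof (cases "j = i")
      case True then show ?thesis by (simp add: t_def)
    next
      case False
      then have "h j \<in> \<sigma> - {h i}" "v \<in> \<sigma> - {h i}"
        using im j i hi v inj by (auto simp: inj_on_eq_iff)
      then show ?thesis using N False unfolding outward_normal_def by simp
    qed
    have nu: "\<nu> c = - t * Y $$ (c, i)" if c: "c < n" for c
    proof -
      let ?n = "vec n \<nu>"
      have "?X *\<^sub>v ?n = (- t) \<cdot>\<^sub>v unit_vec n i"
        using Xn by (intro eq_vecI) (auto simp: scalar_prod_def lessThan_atLeast0 unit_vec_def mult.commute)
      then have "Y *\<^sub>v (?X *\<^sub>v ?n) = Y *\<^sub>v ((- t) \<cdot>\<^sub>v unit_vec n i)" by simp
      moreover have "Y *\<^sub>v (?X *\<^sub>v ?n) = ?n"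
        using assoc_mult_mat_vec[OF Y X, of ?n] YX by simp
      ultimately have "?n = Y *\<^sub>v ((- t) \<cdot>\<^sub>v unit_vec n i)" by simp
      then have "?n $ c = (Y *\<^sub>v ((- t) \<cdot>\<^sub>v unit_vec n i)) $ c" by simp
      then show ?thesis using c i Y by (simp add: scalar_prod_right_unit)
    qed
    \<comment> \<open>Unit length determines \<open>t\<close>.\<close>
    have "1 = (\<Sum>c<n. (\<nu> c)^2)" using N by (simp add: outward_normal_def)
    also have "\<dots> = (\<Sum>c<n. t^2 * (Y $$ (c, i))^2)"
      by (rule sum.cong) (auto simp: nu power_mult_distrib)
    also have "\<dots> = (t * ?s)^2" using s2 by (simp add: sum_distrib_left power2_eq_square mult_ac)
    finally have "(t * ?s)^2 = 1^2" by (simp only: power_one)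
    then have "t * ?s = 1"
      by (rule power2_eq_imp_eq) (use t s0 in \<open>simp_all only: zero_le_one mult_nonneg_nonneg less_imp_le\<close>)
    then have "t = 1 / ?s" using s0 by (simp add: field_simps)
    then show "\<nu> = ?N" using nu N by (auto simp: outward_normal_def fun_eq_iff)
  next
    assume N: "\<nu> = ?N"
    \<comment> \<open>All conditions on \<open>?N\<close> reduce to its pairings with the edge
      vectors at \<open>v\<close>, since any other difference of vertices is a difference of two of
      these.\<close>
    have Xn: "(\<Sum>c<n. \<nu> c * (p (h j) c - p v c)) = (if j = i then - 1 / ?s else 0)" if j: "j < n" for j
    proof -
      have "(\<Sum>c<n. \<nu> c * (p (h j) c - p v c)) = (\<Sum>c<n. (p (h j) c - p v c) * Y $$ (c, i)) * (- 1 / ?s)"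
        unfolding sum_distrib_right by (rule sum.cong) (auto simp: N)
      then show ?thesis by (simp add: XYe[OF j])
    qed
    have X0: "(\<Sum>c<n. \<nu> c * (p a c - p v c)) = 0" if "a \<in> \<sigma> - {h i}" for a
    proof (cases "a = v")
      case False
      then show ?thesis using cases[OF that False] Xn by auto
    qed simp
    have diff: "(\<Sum>c<n. \<nu> c * (p a c - p b c))
      = (\<Sum>c<n. \<nu> c * (p a c - p v c)) - (\<Sum>c<n. \<nu> c * (p b c - p v c))" for a b
      by (simp add: algebra_simps flip: sum_subtractf)
    have "(\<Sum>c<n. (\<nu> c)^2) = (\<Sum>c<n. (Y $$ (c, i))^2) / ?s^2"
      unfolding sum_divide_distrib by (rule sum.cong) (auto simp: N power_divide)
    then have "(\<Sum>c<n. (\<nu> c)^2) = 1" using s2 spos by (simp add: power2_eq_square)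
    moreover have "\<forall>c\<ge>n. \<nu> c = 0" by (simp add: N)
    moreover have "(\<Sum>c<n. \<nu> c * (p a c - p b c)) = 0" if "a \<in> \<sigma> - {h i}" "b \<in> \<sigma> - {h i}" for a b
      using X0[OF that(1)] X0[OF that(2)] diff[of a b] by simp
    moreover have "(\<Sum>c<n. \<nu> c * (p (h i) c - p b c)) < 0" if "b \<in> \<sigma> - {h i}" for b
      using X0[OF that] Xn[OF i] s0 diff[of "h i" b] by simp
    ultimately show "outward_normal n \<sigma> p (h i) \<nu>"
      unfolding outward_normal_def by blast
  qed
qed

section \<open>Equivariance of dihedral angles and volumes\<close>

text \<open>With \<open>?X\<close> the matrix of edge vectors, \<open>?X * ?X\<^sup>T\<close> is the
  Gram matrix, so for the inverse \<open>Y\<close> of \<open>?X\<close> the product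
  \<open>Y\<^sup>T * Y\<close> is \<open>B\<close>. The normals are negated normalized columns of
  \<open>Y\<close>; their inner products are therefore scaled entries of \<open>B\<close>, and the
  realization drops out.\<close>

lemma inner_outward_normals:
  assumes p: "realizes n z \<sigma> p" and v: "v \<in> \<sigma>" and h: "bij_betw h {0..<n} (\<sigma> - {v})"
    and B: "B \<in> carrier_mat n n" "B * gram_mat z v n h = 1\<^sub>m n"
    and ij: "i < n" "j < n"
  shows "(\<Sum>c<n. (SOME \<nu>. outward_normal n \<sigma> p (h i) \<nu>) c * (SOME \<nu>. outward_normal n \<sigma> p (h j) \<nu>) c)
    = B $$ (i, j) / (sqrt (B $$ (i, i)) * sqrt (B $$ (j, j)))"
    and "B $$ (i, j) = B $$ (j, i)"
proof -
  let ?X = "mat n n (\<lambda>(i, c). p (h i) c - p v c)"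
  have X: "?X \<in> carrier_mat n n" by simp
  have hs: "h i \<in> \<sigma>" if "i < n" for i using h that by (auto simp: bij_betw_def)
  have XX: "?X * ?X\<^sup>T = gram_mat z v n h"
    by (rule eq_matI)
      (auto simp: gram_mat_def scalar_prod_def hs realizes_gram[OF p v] simp flip: lessThan_atLeast0)
  have "Determinant.det B * (Determinant.det ?X * Determinant.det ?X) = 1"
    using det_mult[OF B(1), of "gram_mat z v n h"] det_mult[OF X, of "?X\<^sup>T"] det_transpose[OF X] B(2)
    by (simp add: XX) (simp add: gram_mat_def)
  then have "Determinant.det ?X \<noteq> 0" by auto
  then obtain Y where Y: "Y \<in> carrier_mat n n" "?X * Y = 1\<^sub>m n" "Y * ?X = 1\<^sub>m n"
    using ex_mat_inverse[OF X] by blast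
  have Xt: "?X\<^sup>T \<in> carrier_mat n n" and Yt: "Y\<^sup>T \<in> carrier_mat n n" using Y by auto
  have XtYt: "?X\<^sup>T * Y\<^sup>T = 1\<^sub>m n"
    using transpose_mult[OF Y(1) X] Y(3) by simp
  have "(?X * ?X\<^sup>T) * (Y\<^sup>T * Y) = ?X * ((?X\<^sup>T * Y\<^sup>T) * Y)"
    using assoc_mult_mat[OF X Xt, of "Y\<^sup>T * Y" n] assoc_mult_mat[OF Xt Yt Y(1)] Yt Y(1) by simp
  then have G: "gram_mat z v n h * (Y\<^sup>T * Y) = 1\<^sub>m n"
    using Y by (simp add: XX XtYt)
  have "B * (gram_mat z v n h * (Y\<^sup>T * Y)) = (B * gram_mat z v n h) * (Y\<^sup>T * Y)"
    by (rule assoc_mult_mat[symmetric, of _ n n _ n _ n]) (use B Y in \<open>auto simp: gram_mat_def\<close>)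
  then have BY: "B = Y\<^sup>T * Y" using G B Y by simp
  have Be: "B $$ (i, j) = (\<Sum>c<n. Y $$ (c, i) * Y $$ (c, j))" if "i < n" "j < n" for i j
    unfolding BY using that Y(1) by (simp add: scalar_prod_def lessThan_atLeast0)
  show "B $$ (i, j) = B $$ (j, i)" using ij by (simp add: Be mult.commute)
  have nu: "(SOME \<nu>. outward_normal n \<sigma> p (h i) \<nu>) c = - Y $$ (c, i) / sqrt (B $$ (i, i))"
    if "i < n" "c < n" for i c
    using that by (simp add: outward_normal_iff[OF v h that(1) Y(1,2)] Be power2_eq_square)
  show "(\<Sum>c<n. (SOME \<nu>. outward_normal n \<sigma> p (h i) \<nu>) c * (SOME \<nu>. outward_normal n \<sigma> p (h j) \<nu>) c)
    = B $$ (i, j) / (sqrt (B $$ (i, i)) * sqrt (B $$ (j, j)))"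
    by (simp add: nu ij Be[OF ij] sum_divide_distrib)
qed

text \<open>The metric condition localized to one simplex and its faces, from which a realization of
  that simplex is built.\<close>

definition gram_pos :: "('v set \<Rightarrow> real) \<Rightarrow> 'v set \<Rightarrow> bool" where
  "gram_pos z \<sigma> \<longleftrightarrow> (\<forall>\<tau>\<subseteq>\<sigma>. 2 \<le> card \<tau> \<longrightarrow> 0 < detA z \<tau>)"

text \<open>Every choice inside \<open>dihedral\<close> cancels: the realization and the normals
  because only \<open>B\<close> survives, the order of the two vertices because \<open>B\<close> is
  symmetric. The base \<open>v\<close> lies in \<tau>, so both facets pass through it.\<close>

lemma dihedral_eq:
  assumes fin: "finite \<sigma>" and card: "card \<sigma> = n + 1" and pos: "gram_pos z \<sigma>"
    and v: "v \<in> \<sigma>" and h: "bij_betw h {0..<n} (\<sigma> - {v})"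
    and B: "B \<in> carrier_mat n n" "B * gram_mat z v n h = 1\<^sub>m n"
    and ij: "i < n" "j < n" "i \<noteq> j" and \<tau>: "\<sigma> - \<tau> = {h i, h j}"
  shows "dihedral n z \<tau> \<sigma>
    = 1/2 - arccos (B $$ (i, j) / (sqrt (B $$ (i, i)) * sqrt (B $$ (j, j)))) / (2 * pi)"
proof -
  define p where "p = (SOME p. realizes n z \<sigma> p)"
  have p: "realizes n z \<sigma> p"
  proof -
    have "\<exists>p. realizes n z \<sigma> p" using ex_realizes[OF fin card] pos by (simp add: gram_pos_def)
    then show ?thesis unfolding p_def by (rule someI_ex)
  qed
  define w1 where "w1 = (SOME w. w \<in> \<sigma> - \<tau>)"
  define w2 where "w2 = (SOME w. w \<in> \<sigma> - \<tau> \<and> w \<noteq> w1)"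
  have "h i \<noteq> h j" using bij_betw_imp_inj_on[OF h] ij by (simp add: inj_on_eq_iff)
  have w1: "w1 \<in> {h i, h j}" unfolding w1_def \<tau> by (rule someI[of _ "h i"]) simp
  \<comment> \<open>An explicit witness for the second choice, whichever vertex was picked
    first.\<close>
  have "(if w1 = h i then h j else h i) \<in> \<sigma> - \<tau> \<and> (if w1 = h i then h j else h i) \<noteq> w1"
    unfolding \<tau> using \<open>h i \<noteq> h j\<close> by simp
  then have "w2 \<in> \<sigma> - \<tau> \<and> w2 \<noteq> w1" unfolding w2_def by (rule someI)
  then have w2: "w2 \<in> {h i, h j}" "w2 \<noteq> w1" unfolding \<tau> by simp_all
  have d: "dihedral n z \<tau> \<sigma> = 1/2 - arccos (\<Sum>c<n. (SOME \<nu>. outward_normal n \<sigma> p w1 \<nu>) c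
      * (SOME \<nu>. outward_normal n \<sigma> p w2 \<nu>) c) / (2 * pi)"
    by (simp add: dihedral_def Let_def p_def w1_def w2_def)
  note inner = inner_outward_normals[OF p v h B]
  from w1 w2 have "w1 = h i \<and> w2 = h j \<or> w1 = h j \<and> w2 = h i" by auto
  then show ?thesis
    using inner(1)[OF ij(1,2)] inner(1)[OF ij(2,1)] inner(2)[OF ij(1,2)] by (auto simp: d mult.commute)
qed

section \<open>Transport of metrics along an injective vertex map\<close>

lemma zz_refl_metric:
  assumes "inj_on \<theta> \<sigma>" "u \<in> \<sigma>" "w \<in> \<sigma>"
  shows "zz (refl_metric \<theta> z) u w = zz z (\<theta> u) (\<theta> w)"
  using assms by (auto simp: zz_def refl_metric_def inj_on_eq_iff)

text \<open>An equality of matrices and not only of determinants, so that the inverses agree as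
  well.\<close>

lemma gram_mat_refl_metric:
  assumes \<theta>: "inj_on \<theta> \<sigma>" and v: "v \<in> \<sigma>" and h: "bij_betw h {0..<k} (\<sigma> - {v})"
  shows "gram_mat (refl_metric \<theta> z) v k h = gram_mat z (\<theta> v) k (\<theta> \<circ> h)"
proof -
  have "h i \<in> \<sigma>" if "i < k" for i using h that by (auto simp: bij_betw_def)
  then show ?thesis unfolding gram_mat_def
    by (intro eq_matI) (auto simp: gram_entry_def zz_refl_metric[OF \<theta>] v)
qed

lemma bij_betw_enumeration_image:
  assumes \<theta>: "inj_on \<theta> \<sigma>" and v: "v \<in> \<sigma>" and h: "bij_betw h {0..<k} (\<sigma> - {v})"
  shows "bij_betw (\<theta> \<circ> h) {0..<k} (\<theta> ` \<sigma> - {\<theta> v})"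
proof -
  have "bij_betw \<theta> (\<sigma> - {v}) (\<theta> ` \<sigma> - {\<theta> v})"
    using \<theta> v by (auto simp: bij_betw_def inj_on_def)
  then show ?thesis by (rule bij_betw_trans[OF h])
qed

text \<open>The base vertices picked by \<open>SOME\<close> in \<sigma> and in its image need not
  correspond under \<theta>; base independence allows the comparison at \<open>v\<close> and
  \<open>\<theta> v\<close>.\<close>

lemma detA_refl_metric:
  assumes \<theta>: "inj_on \<theta> \<sigma>" and fin: "finite \<sigma>" "\<sigma> \<noteq> {}"
  shows "detA (refl_metric \<theta> z) \<sigma> = detA z (\<theta> ` \<sigma>)"
proof -
  obtain v where v: "v \<in> \<sigma>" using fin by auto
  have "finite (\<sigma> - {v})" using fin by simp
  then obtain h k where h: "bij_betw h {0..<k::nat} (\<sigma> - {v})"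
    using ex_bij_betw_nat_finite by blast
  show ?thesis
    using detA_eq_det_gram_mat[OF v h] detA_eq_det_gram_mat[OF _ bij_betw_enumeration_image[OF \<theta> v h]] v
    by (simp add: gram_mat_refl_metric[OF \<theta> v h])
qed

lemma svol_refl_metric:
  assumes "inj_on \<theta> \<sigma>" "finite \<sigma>" "\<sigma> \<noteq> {}"
  shows "svol (refl_metric \<theta> z) \<sigma> = svol z (\<theta> ` \<sigma>)"
  using assms by (simp add: svol_def detA_refl_metric card_image)

lemma gram_pos_refl_metric:
  assumes \<theta>: "inj_on \<theta> \<sigma>" and fin: "finite \<sigma>" and pos: "gram_pos z (\<theta> ` \<sigma>)"
  shows "gram_pos (refl_metric \<theta> z) \<sigma>"
  unfolding gram_pos_def
proof (intro allI impI)
  fix \<tau> assume \<tau>: "\<tau> \<subseteq> \<sigma>" "2 \<le> card \<tau>"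
  have inj: "inj_on \<theta> \<tau>" using \<theta> \<tau> by (auto intro: inj_on_subset)
  have "\<tau> \<noteq> {}" "finite \<tau>" using \<tau> fin by (auto intro: finite_subset)
  then show "0 < detA (refl_metric \<theta> z) \<tau>"
    using pos \<tau> inj card_image[OF inj] by (auto simp: gram_pos_def detA_refl_metric image_mono)
qed

text \<open>One matrix \<open>B\<close> inverts both Gram matrices, so both angles are given by the
  same formula.\<close>

lemma dihedral_refl_metric:
  assumes \<theta>: "inj_on \<theta> \<sigma>" and fin: "finite \<sigma>" and card: "card \<sigma> = n + 1"
    and \<tau>: "\<tau> \<subseteq> \<sigma>" "card \<tau> = n - 1" "2 \<le> n" and pos: "gram_pos z (\<theta> ` \<sigma>)"
  shows "dihedral n (refl_metric \<theta> z) \<tau> \<sigma> = dihedral n z (\<theta> ` \<tau>) (\<theta> ` \<sigma>)"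
proof -
  \<comment> \<open>A base in \<tau> keeps both vertices of \<open>\<sigma> - \<tau>\<close> among
    the enumerated ones; \<tau> is nonempty because \<open>2 \<le> n\<close>.\<close>
  obtain v where v: "v \<in> \<tau>" using \<tau> by fastforce
  then have v\<sigma>: "v \<in> \<sigma>" using \<tau> by auto
  obtain h where h: "bij_betw h {0..<n} (\<sigma> - {v})" using ex_enumeration[OF fin card v\<sigma>] .
  have "card (\<sigma> - \<tau>) = 2" using \<tau> card fin by (simp add: card_Diff_subset finite_subset)
  then obtain w1 w2 where w: "\<sigma> - \<tau> = {w1, w2}" "w1 \<noteq> w2" by (meson card_2_iff)
  then have "w1 \<in> \<sigma>" "w1 \<noteq> v" "w2 \<in> \<sigma>" "w2 \<noteq> v" using v by auto
  obtain i where i: "i < n" "w1 = h i" by (rule enumeration_elem[OF h \<open>w1 \<in> \<sigma>\<close> \<open>w1 \<noteq> v\<close>])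
  obtain j where j: "j < n" "w2 = h j" by (rule enumeration_elem[OF h \<open>w2 \<in> \<sigma>\<close> \<open>w2 \<noteq> v\<close>])
  have ij: "i \<noteq> j" using w i j by auto
  note h' = bij_betw_enumeration_image[OF \<theta> v\<sigma> h]
  have pos': "gram_pos (refl_metric \<theta> z) \<sigma>" by (rule gram_pos_refl_metric[OF \<theta> fin pos])
  have card': "card (\<theta> ` \<sigma>) = n + 1" using card_image[OF \<theta>] card by simp
  have A: "gram_mat z (\<theta> v) n (\<theta> \<circ> h) \<in> carrier_mat n n" by (simp add: gram_mat_def)
  have "0 < detA z (\<theta> ` \<sigma>)" using pos card' \<tau> by (auto simp: gram_pos_def)
  then have "Determinant.det (gram_mat z (\<theta> v) n (\<theta> \<circ> h)) \<noteq> 0"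
    using detA_eq_det_gram_mat[OF _ h', of z] v\<sigma> by auto
  then obtain B where B: "B \<in> carrier_mat n n" "B * gram_mat z (\<theta> v) n (\<theta> \<circ> h) = 1\<^sub>m n"
    using ex_mat_inverse[OF A] by blast
  have B': "B * gram_mat (refl_metric \<theta> z) v n h = 1\<^sub>m n"
    using B by (simp add: gram_mat_refl_metric[OF \<theta> v\<sigma> h])
  have "\<theta> ` \<sigma> - \<theta> ` \<tau> = \<theta> ` (\<sigma> - \<tau>)"
    using inj_on_image_set_diff[OF \<theta>, of \<sigma> \<tau>] \<tau> by auto
  then have w': "\<theta> ` \<sigma> - \<theta> ` \<tau> = {(\<theta> \<circ> h) i, (\<theta> \<circ> h) j}" using w i j by simp
  have w: "\<sigma> - \<tau> = {h i, h j}" using w i j by simp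
  have "dihedral n z (\<theta> ` \<tau>) (\<theta> ` \<sigma>)
    = 1/2 - arccos (B $$ (i, j) / (sqrt (B $$ (i, i)) * sqrt (B $$ (j, j)))) / (2 * pi)"
    by (rule dihedral_eq[OF _ card' pos _ h' B i(1) j(1) ij w']) (use fin v\<sigma> in auto)
  moreover have "dihedral n (refl_metric \<theta> z) \<tau> \<sigma>
    = 1/2 - arccos (B $$ (i, j) / (sqrt (B $$ (i, i)) * sqrt (B $$ (j, j)))) / (2 * pi)"
    by (rule dihedral_eq[OF fin card pos' v\<sigma> h B(1) B' i(1) j(1) ij w])
  ultimately show ?thesis by simp
qed

section \<open>Reflection positivity of product Lebesgue measure\<close>

text \<open>Relabelling coordinates along a bijection preserves the product measure, as is checked
  on boxes.\<close>

lemma integral_PiM_lborel_reindex: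
  fixes g :: "('i \<Rightarrow> real) \<Rightarrow> complex" and \<phi> :: "'i \<Rightarrow> 'i"
  assumes \<phi>: "bij_betw \<phi> A B" and fin: "finite A"
  shows "(\<integral>y. g (\<lambda>e\<in>A. y (\<phi> e)) \<partial>PiM B (\<lambda>_. lborel)) = (\<integral>x. g x \<partial>PiM A (\<lambda>_. lborel))"
proof -
  interpret product_sigma_finite "\<lambda>_::'i. lborel :: real measure" by standard
  let ?A = "PiM A (\<lambda>_. lborel :: real measure)" and ?B = "PiM B (\<lambda>_. lborel :: real measure)"
  define \<Phi> where "\<Phi> y = (\<lambda>e\<in>A. y (\<phi> e))" for y :: "'i \<Rightarrow> real"
  define \<Psi> where "\<Psi> x = (\<lambda>b\<in>B. x (inv_into A \<phi> b))" for x :: "'i \<Rightarrow> real"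
  have finB: "finite B" and inj: "inj_on \<phi> A" and im: "\<phi> ` A = B"
    using \<phi> fin by (auto simp: bij_betw_def)
  have inv: "inv_into A \<phi> b \<in> A" "\<phi> (inv_into A \<phi> b) = b" if "b \<in> B" for b
    using that im by (auto simp: inv_into_into f_inv_into_f)
  have \<Phi>: "\<Phi> \<in> measurable ?B ?A"
    unfolding \<Phi>_def by (rule measurable_restrict) (use im in \<open>auto intro!: measurable_component_singleton\<close>)
  have \<Psi>: "\<Psi> \<in> measurable ?A ?B"
    unfolding \<Psi>_def by (rule measurable_restrict) (use inv in \<open>auto intro!: measurable_component_singleton\<close>)
  have \<Phi>\<Psi>: "\<Phi> (\<Psi> x) = x" if "x \<in> space ?A" for x
    using that inj im by (auto simp: \<Phi>_def \<Psi>_def fun_eq_iff space_PiM PiE_def extensional_def)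
  have distr: "distr ?B ?A \<Phi> = ?A"
  proof (rule PiM_eqI[OF fin])
    fix X :: "'i \<Rightarrow> real set" assume X: "\<And>i. i \<in> A \<Longrightarrow> X i \<in> sets lborel"
    have "\<Phi> -` Pi\<^sub>E A X \<inter> space ?B = Pi\<^sub>E B (\<lambda>b. X (inv_into A \<phi> b))"
    proof (intro equalityI subsetI)
      fix y assume "y \<in> \<Phi> -` Pi\<^sub>E A X \<inter> space ?B"
      then have y: "\<And>e. e \<in> A \<Longrightarrow> y (\<phi> e) \<in> X e" "y \<in> extensional B"
        by (auto simp: \<Phi>_def space_PiM PiE_def Pi_def)
      show "y \<in> Pi\<^sub>E B (\<lambda>b. X (inv_into A \<phi> b))"
        using y(1)[OF inv(1)] inv(2) y(2) by (auto simp: PiE_def)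
    next
      fix y assume y: "y \<in> Pi\<^sub>E B (\<lambda>b. X (inv_into A \<phi> b))"
      have "y (\<phi> e) \<in> X e" if "e \<in> A" for e
        using PiE_mem[OF y, of "\<phi> e"] that im inj by auto
      then show "y \<in> \<Phi> -` Pi\<^sub>E A X \<inter> space ?B"
        using y by (auto simp: \<Phi>_def space_PiM PiE_def)
    qed
    then have "emeasure (distr ?B ?A \<Phi>) (Pi\<^sub>E A X) = emeasure ?B (Pi\<^sub>E B (\<lambda>b. X (inv_into A \<phi> b)))"
      using X fin by (subst emeasure_distr[OF \<Phi>]) (auto intro!: sets_PiM_I_finite)
    also have "\<dots> = (\<Prod>b\<in>B. emeasure lborel (X (inv_into A \<phi> b)))"
      by (rule emeasure_PiM[OF finB]) (use X inv in auto)
    also have "\<dots> = (\<Prod>e\<in>A. emeasure lborel (X e))"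
      by (subst prod.reindex_bij_betw[OF \<phi>, symmetric]) (use inj in \<open>auto intro!: prod.cong\<close>)
    finally show "emeasure (distr ?B ?A \<Phi>) (Pi\<^sub>E A X) = (\<Prod>e\<in>A. emeasure lborel (X e))" .
  qed simp
  have "(\<integral>y. g (\<Phi> y) \<partial>?B) = (\<integral>x. g x \<partial>?A)"
  proof (cases "g \<in> borel_measurable ?A")
    case True
    then show ?thesis using integral_distr[OF \<Phi> True] distr by simp
  next
    \<comment> \<open>Both integrals are 0 by convention here: \<open>\<Psi>\<close> is a measurable
      right inverse of \<open>\<Phi>\<close>, so measurability of the composite would pass to
      \<open>g\<close>.\<close>
    case False
    have "(\<lambda>y. g (\<Phi> y)) \<notin> borel_measurable ?B"
    proof
      assume "(\<lambda>y. g (\<Phi> y)) \<in> borel_measurable ?B"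
      from measurable_compose[OF \<Psi> this] have "(\<lambda>x. g (\<Phi> (\<Psi> x))) \<in> borel_measurable ?A" .
      then have "g \<in> borel_measurable ?A"
        by (rule measurable_cong[THEN iffD1, rotated]) (simp add: \<Phi>\<Psi>)
      with False show False ..
    qed
    then show ?thesis
      using False by (metis borel_measurable_integrable not_integrable_integral_eq)
  qed
  then show ?thesis by (simp add: \<Phi>_def)
qed

lemma integral_nonneg_Reals:
  fixes J :: "'a \<Rightarrow> complex"
  assumes "\<And>x. x \<in> space M \<Longrightarrow> J x \<in> \<real>\<^sub>\<ge>\<^sub>0"
  shows "(\<integral>x. J x \<partial>M) \<in> \<real>\<^sub>\<ge>\<^sub>0"
proof -
  have "(\<integral>x. J x \<partial>M) = (\<integral>x. complex_of_real (Re (J x)) \<partial>M)"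
    using assms by (intro Bochner_Integration.integral_cong) (auto simp: complex_nonneg_Reals_iff complex_eq_iff)
  also have "\<dots> = complex_of_real (\<integral>x. Re (J x) \<partial>M)" by simp
  finally have eq: "(\<integral>x. J x \<partial>M) = complex_of_real (\<integral>x. Re (J x) \<partial>M)" .
  have "(\<integral>x. Re (J x) \<partial>M) \<ge> 0"
    using assms by (intro integral_nonneg_AE) (auto simp: complex_nonneg_Reals_iff)
  then show ?thesis unfolding eq by simp
qed

text \<open>With the coordinates on \<open>E\<^sub>0\<close> held fixed, the integrand is a function
  of the coordinates on \<open>A\<close> times the conjugate of the same function of the coordinates
  on \<open>B\<close>, so the partial integral is a squared modulus.\<close>

lemma reflection_positivity:
  fixes F :: "('i \<Rightarrow> real) \<Rightarrow> complex"
  assumes fin: "finite E\<^sub>0" "finite A" "finite B"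
    and disj: "E\<^sub>0 \<inter> A = {}" "E\<^sub>0 \<inter> B = {}" "A \<inter> B = {}"
    and \<phi>: "bij_betw \<phi> A B" and fixed: "\<And>e. e \<in> E\<^sub>0 \<Longrightarrow> \<phi> e = e"
  shows "(\<integral>z. cnj (F (\<lambda>e\<in>E\<^sub>0 \<union> A. z (\<phi> e))) * F (restrict z (E\<^sub>0 \<union> A))
    \<partial>PiM (E\<^sub>0 \<union> (A \<union> B)) (\<lambda>_. lborel)) \<in> \<real>\<^sub>\<ge>\<^sub>0" (is "(\<integral>z. ?g z \<partial>?P) \<in> _")
\<comment> \<open>Fubini is applied only to integrable functions; otherwise the integral is 0 by
  convention. The same distinction recurs for the inner integral at each
  \<open>z\<^sub>0\<close>.\<close>
proof (cases "integrable ?P ?g")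
  case False
  then show ?thesis by (simp add: not_integrable_integral_eq)
next
  case True
  interpret product_sigma_finite "\<lambda>_::'i. lborel :: real measure" by standard
  have "(\<integral>z. ?g z \<partial>?P) = (\<integral>z\<^sub>0. (\<integral>w. ?g (merge E\<^sub>0 (A \<union> B) (z\<^sub>0, w))
      \<partial>PiM (A \<union> B) (\<lambda>_. lborel)) \<partial>PiM E\<^sub>0 (\<lambda>_. lborel))"
    by (rule product_integral_fold[OF _ _ _ True]) (use fin disj in auto)
  also have "\<dots> \<in> \<real>\<^sub>\<ge>\<^sub>0"
  proof (rule integral_nonneg_Reals)
    fix z\<^sub>0 :: "'i \<Rightarrow> real"
    let ?h = "\<lambda>w. ?g (merge E\<^sub>0 (A \<union> B) (z\<^sub>0, w))"
    let ?Q = "PiM (A \<union> B) (\<lambda>_. lborel :: real measure)"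
    show "(\<integral>w. ?h w \<partial>?Q) \<in> \<real>\<^sub>\<ge>\<^sub>0"
    proof (cases "integrable ?Q ?h")
      case False
      then show ?thesis by (simp add: not_integrable_integral_eq)
    next
      case True
      define F\<^sub>0 where "F\<^sub>0 x = F (merge E\<^sub>0 A (z\<^sub>0, x))" for x
      have h: "?h (merge A B (x, y)) = F\<^sub>0 x * cnj (F\<^sub>0 (\<lambda>e\<in>A. y (\<phi> e)))" for x y
      proof -
        have 1: "restrict (merge E\<^sub>0 (A \<union> B) (z\<^sub>0, merge A B (x, y))) (E\<^sub>0 \<union> A) = merge E\<^sub>0 A (z\<^sub>0, x)"
          by (auto simp: merge_def fun_eq_iff)
        have "\<phi> e \<in> B" if "e \<in> A" for e using \<phi> that by (auto simp: bij_betw_def)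
        then have "\<phi> e \<in> B" "\<phi> e \<notin> E\<^sub>0" "\<phi> e \<notin> A" if "e \<in> A" for e
          using disj that by blast+
        then have 2: "(\<lambda>e\<in>E\<^sub>0 \<union> A. merge E\<^sub>0 (A \<union> B) (z\<^sub>0, merge A B (x, y)) (\<phi> e))
            = merge E\<^sub>0 A (z\<^sub>0, \<lambda>e\<in>A. y (\<phi> e))"
          using disj fixed by (auto simp: merge_def fun_eq_iff)
        show ?thesis unfolding 1 2 F\<^sub>0_def by simp
      qed
      have "(\<integral>w. ?h w \<partial>?Q)
        = (\<integral>x. (\<integral>y. ?h (merge A B (x, y)) \<partial>PiM B (\<lambda>_. lborel)) \<partial>PiM A (\<lambda>_. lborel))"
        by (rule product_integral_fold[OF _ _ _ True]) (use fin disj in auto)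
      \<comment> \<open>Constant factors leave a complex Bochner integral whether or not the other
        factor is integrable.\<close>
      also have "\<dots> = (\<integral>x. F\<^sub>0 x \<partial>PiM A (\<lambda>_. lborel))
          * (\<integral>y. cnj (F\<^sub>0 (\<lambda>e\<in>A. y (\<phi> e))) \<partial>PiM B (\<lambda>_. lborel))"
        unfolding h by simp
      also have "(\<integral>y. cnj (F\<^sub>0 (\<lambda>e\<in>A. y (\<phi> e))) \<partial>PiM B (\<lambda>_. lborel))
          = cnj (\<integral>x. F\<^sub>0 x \<partial>PiM A (\<lambda>_. lborel))"
        using integral_PiM_lborel_reindex[OF \<phi> fin(2), of "\<lambda>x. cnj (F\<^sub>0 x)"] by simp
      finally have eq: "(\<integral>w. ?h w \<partial>?Q) = (\<integral>x. F\<^sub>0 x \<partial>PiM A (\<lambda>_. lborel))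
          * cnj (\<integral>x. F\<^sub>0 x \<partial>PiM A (\<lambda>_. lborel))" .
      show ?thesis
        unfolding eq complex_mult_cnj by (simp add: complex_nonneg_Reals_iff)
    qed
  qed
  finally show ?thesis .
qed

section \<open>Reflections of pseudomanifolds\<close>

lemma detA_cong:
  assumes fin: "finite \<sigma>" "\<sigma> \<noteq> {}"
    and eq: "\<And>u w. u \<in> \<sigma> \<Longrightarrow> w \<in> \<sigma> \<Longrightarrow> zz z u w = zz z' u w"
  shows "detA z \<sigma> = detA z' \<sigma>"
proof -
  obtain v where v: "v \<in> \<sigma>" using fin by auto
  have "finite (\<sigma> - {v})" using fin by simp
  then obtain h k where h: "bij_betw h {0..<k::nat} (\<sigma> - {v})"
    using ex_bij_betw_nat_finite by blast
  then have "h i \<in> \<sigma>" if "i < k" for i using that by (auto simp: bij_betw_def)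
  then have "gram_mat z v k h = gram_mat z' v k h"
    unfolding gram_mat_def by (intro eq_matI) (auto simp: gram_entry_def eq v)
  then show ?thesis using detA_eq_det_gram_mat[OF v h] by simp
qed

text \<open>The metric enters \<open>dihedral\<close> only through the predicate
  \<open>realizes\<close>, so equal predicates lead to equal choices.\<close>

lemma dihedral_cong:
  assumes "\<And>u w. u \<in> \<sigma> \<Longrightarrow> w \<in> \<sigma> \<Longrightarrow> zz z u w = zz z' u w"
  shows "dihedral n z \<tau> \<sigma> = dihedral n z' \<tau> \<sigma>"
proof -
  have "realizes n z \<sigma> = realizes n z' \<sigma>"
    using assms by (simp add: realizes_iff fun_eq_iff)
  then show ?thesis by (simp add: dihedral_def Let_def)
qed

section \<open>The involution on the simplices of a reflected complex\<close>

locale reflected_complex =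
  fixes n :: nat and K Kp Km :: "'v set set" and \<theta> :: "'v \<Rightarrow> 'v"
  assumes n: "3 \<le> n" and pseudo: "pseudomanifold n K" and is_reflection: "reflection n K \<theta> Kp Km"
begin

lemma finite_vertices: "finite (\<Union>K)" and complex: "simplicial_complex K"
  using pseudo by (auto simp: pseudomanifold_def)

lemma finite_K: "finite K"
  using finite_vertices finite_subset[of K "Pow (\<Union>K)"] by auto

lemma K_simplex: "s \<in> K \<Longrightarrow> finite s" "s \<in> K \<Longrightarrow> s \<noteq> {}"
  using complex by (auto simp: simplicial_complex_def)

lemma K_eq: "K = Kp \<union> Km" and Kp_sub: "Kp \<subseteq> K" and Km_eq: "Km = (`) \<theta> ` Kp"
  using is_reflection by (auto simp: reflection_def)

lemma Kp_face: "s \<in> Kp \<Longrightarrow> t \<subseteq> s \<Longrightarrow> t \<noteq> {} \<Longrightarrow> t \<in> Kp"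
proof -
  have "simplicial_complex Kp" using is_reflection by (simp add: reflection_def pseudomanifold_def)
  then show "s \<in> Kp \<Longrightarrow> t \<subseteq> s \<Longrightarrow> t \<noteq> {} \<Longrightarrow> t \<in> Kp"
    unfolding simplicial_complex_def by blast
qed

lemma theta_theta: "v \<in> \<Union>K \<Longrightarrow> \<theta> (\<theta> v) = v"
  and image_K: "s \<in> K \<Longrightarrow> \<theta> ` s \<in> K"
proof -
  have "\<forall>v\<in>\<Union>K. \<theta> v \<in> \<Union>K \<and> \<theta> (\<theta> v) = v" "\<forall>s\<in>K. \<theta> ` s \<in> K"
    using is_reflection unfolding reflection_def by - (elim conjE, assumption)+
  then show "v \<in> \<Union>K \<Longrightarrow> \<theta> (\<theta> v) = v" "s \<in> K \<Longrightarrow> \<theta> ` s \<in> K" by blast+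
qed

lemma inj_theta: "s \<in> K \<Longrightarrow> inj_on \<theta> s"
  using theta_theta by (intro inj_on_inverseI[of _ \<theta>]) auto

lemma image_twice: "s \<in> K \<Longrightarrow> \<theta> ` (\<theta> ` s) = s"
proof -
  assume "s \<in> K"
  then have "\<theta> (\<theta> v) = v" if "v \<in> s" for v using theta_theta that by blast
  then show ?thesis by (force simp: image_def)
qed

lemma card_image_K: "s \<in> K \<Longrightarrow> card (\<theta> ` s) = card s"
  by (rule card_image[OF inj_theta])

text \<open>\<theta> carries \<open>Kp\<close> into \<open>Km\<close> by definition of
  \<open>Km\<close>, and back because it is an involution.\<close>

lemma image_Kp: "s \<in> K \<Longrightarrow> \<theta> ` s \<in> Kp \<longleftrightarrow> s \<in> Km"
  and image_Km: "s \<in> K \<Longrightarrow> \<theta> ` s \<in> Km \<longleftrightarrow> s \<in> Kp"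
proof -
  have *: "s \<in> Kp \<Longrightarrow> \<theta> ` s \<in> Km" "s \<in> Km \<Longrightarrow> \<theta> ` s \<in> Kp" for s
    using Km_eq image_twice Kp_sub by (auto simp: subset_iff)
  show "\<theta> ` s \<in> Kp \<longleftrightarrow> s \<in> Km" "\<theta> ` s \<in> Km \<longleftrightarrow> s \<in> Kp" if s: "s \<in> K"
    using *[of s] *[of "\<theta> ` s"] unfolding image_twice[OF s] by blast+
qed

lemma image_fixed: "s \<in> Kp \<Longrightarrow> s \<in> Km \<Longrightarrow> \<theta> ` s = s"
proof -
  assume s: "s \<in> Kp" "s \<in> Km"
  have "\<forall>v\<in>\<Union>(Kp \<inter> Km). \<theta> v = v"
    using is_reflection unfolding reflection_def by - (elim conjE, assumption)
  then have "\<theta> v = v" if "v \<in> s" for v using s that by blast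
  then show ?thesis by force
qed

lemma finite_simplices: "finite (simplices_dim K k)"
  using finite_K by (simp add: simplices_dim_def)

lemma image_simplices: "s \<in> simplices_dim K k \<Longrightarrow> \<theta> ` s \<in> simplices_dim K k"
  by (auto simp: simplices_dim_def image_K card_image_K)

lemma bij_simplices: "bij_betw ((`) \<theta>) (simplices_dim K k) (simplices_dim K k)"
  by (rule bij_betw_byWitness[where f' = "(`) \<theta>"])
    (auto simp: image_simplices image_twice simplices_dim_def image_K card_image_K)

lemma bij_cofaces:
  assumes "s \<in> K"
  shows "bij_betw ((`) \<theta>) {u \<in> simplices_dim K k. s \<subseteq> u} {u \<in> simplices_dim K k. \<theta> ` s \<subseteq> u}"
proof (rule bij_betw_byWitness[where f' = "(`) \<theta>"])
  show "(`) \<theta> ` {u \<in> simplices_dim K k. \<theta> ` s \<subseteq> u} \<subseteq> {u \<in> simplices_dim K k. s \<subseteq> u}"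
  proof (intro subsetI, elim imageE)
    fix t u assume u: "u \<in> {u \<in> simplices_dim K k. \<theta> ` s \<subseteq> u}" and t: "t = \<theta> ` u"
    then have "\<theta> ` \<theta> ` s \<subseteq> \<theta> ` u" by (blast intro: image_mono)
    then show "t \<in> {u \<in> simplices_dim K k. s \<subseteq> u}"
      using u t assms by (simp add: image_simplices image_twice)
  qed
qed (auto simp: image_twice simplices_dim_def image_K card_image_K)

lemma bij_faces:
  assumes "s \<in> K"
  shows "bij_betw ((`) \<theta>) {u \<in> simplices_dim K k. u \<subseteq> s} {u \<in> simplices_dim K k. u \<subseteq> \<theta> ` s}"
proof (rule bij_betw_byWitness[where f' = "(`) \<theta>"])
  show "(`) \<theta> ` {u \<in> simplices_dim K k. u \<subseteq> \<theta> ` s} \<subseteq> {u \<in> simplices_dim K k. u \<subseteq> s}"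
  proof (intro subsetI, elim imageE)
    fix t u assume u: "u \<in> {u \<in> simplices_dim K k. u \<subseteq> \<theta> ` s}" and t: "t = \<theta> ` u"
    then have "\<theta> ` u \<subseteq> \<theta> ` \<theta> ` s" by (blast intro: image_mono)
    then show "t \<in> {u \<in> simplices_dim K k. u \<subseteq> s}"
      using u t assms by (simp add: image_simplices image_twice)
  qed
qed (auto simp: image_twice simplices_dim_def image_K card_image_K)

text \<open>Boundary membership rests on a count of cofaces, which \<theta> preserves; the converse
  is the same implication applied to the image.\<close>

lemma image_boundary:
  assumes \<tau>: "\<tau> \<in> K"
  shows "\<theta> ` \<tau> \<in> boundary n K \<longleftrightarrow> \<tau> \<in> boundary n K"
proof -
  have *: "\<theta> ` \<tau> \<in> boundary n K" if \<tau>: "\<tau> \<in> boundary n K" for \<tau>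
  proof -
    from \<tau> obtain s where s: "s \<in> simplices_dim K (n - 1)"
      "card {u \<in> simplices_dim K n. s \<subseteq> u} = 1" "\<tau> \<subseteq> s" "\<tau> \<noteq> {}"
      by (auto simp: boundary_def)
    then have "s \<in> K" by (simp add: simplices_dim_def)
    then have "card {u \<in> simplices_dim K n. \<theta> ` s \<subseteq> u} = 1"
      using bij_betw_same_card[OF bij_cofaces[of s n]] s by simp
    then show ?thesis
      unfolding boundary_def using s image_simplices[OF s(1)] by blast
  qed
  from *[of \<tau>] *[of "\<theta> ` \<tau>"] show ?thesis using image_twice[OF \<tau>] by auto
qed

section \<open>Splitting of the action by weights\<close>

definition weight :: "'v set \<Rightarrow> real" where
  "weight s = (if s \<in> Kp then if s \<in> Km then 1/2 else 1 else 0)"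

lemma weight_sum: "s \<in> K \<Longrightarrow> weight s + weight (\<theta> ` s) = 1"
  using K_eq by (auto simp: weight_def image_Kp image_Km)

text \<open>Reindexing the second sum by \<theta> moves each weight to the mirror image, and the
  weights of a simplex and its mirror image add up to 1.\<close>

lemma sum_simplices_split:
  assumes "\<And>s. s \<in> simplices_dim K k \<Longrightarrow> T' s = T (\<theta> ` s)"
  shows "(\<Sum>s\<in>simplices_dim K k. T s)
    = (\<Sum>s\<in>simplices_dim K k. weight s * T s) + (\<Sum>s\<in>simplices_dim K k. weight s * T' s)"
proof -
  have "(\<Sum>s\<in>simplices_dim K k. weight s * T' s)
      = (\<Sum>s\<in>simplices_dim K k. weight (\<theta> ` \<theta> ` s) * T (\<theta> ` s))"
    by (rule sum.cong) (auto simp: assms image_twice simplices_dim_def)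
  also have "\<dots> = (\<Sum>s\<in>simplices_dim K k. weight (\<theta> ` s) * T s)"
    by (rule sum.reindex_bij_betw[OF bij_simplices])
  finally have "(\<Sum>s\<in>simplices_dim K k. weight s * T s) + (\<Sum>s\<in>simplices_dim K k. weight s * T' s)
      = (\<Sum>s\<in>simplices_dim K k. (weight s + weight (\<theta> ` s)) * T s)"
    by (simp add: sum.distrib distrib_right)
  also have "\<dots> = (\<Sum>s\<in>simplices_dim K k. T s)"
    by (rule sum.cong) (auto simp: weight_sum simplices_dim_def)
  finally show ?thesis ..
qed

definition bone :: "('v set \<Rightarrow> real) \<Rightarrow> 'v set \<Rightarrow> real" where
  "bone z \<tau> = (if \<tau> \<in> boundary n K then 1/2 else 1) * svol z \<tau>"

text \<open>The dihedral terms are grouped by top simplex. A bone in \<open>Kp \<inter> Km\<close>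
  meets top simplices of both sides, so each term must carry the weight of \<sigma>, not of \<tau>,
  to depend on one side only.\<close>

definition angle :: "('v set \<Rightarrow> real) \<Rightarrow> 'v set \<Rightarrow> real" where
  "angle z \<sigma> = (\<Sum>\<tau> | \<tau> \<in> simplices_dim K (n - 2) \<and> \<tau> \<subseteq> \<sigma>. dihedral n z \<tau> \<sigma> * svol z \<tau>)"

definition half_action :: "real \<Rightarrow> real \<Rightarrow> ('v set \<Rightarrow> real) \<Rightarrow> real" where
  "half_action gam lam z =
    gam * ((\<Sum>\<tau>\<in>simplices_dim K (n - 2). weight \<tau> * bone z \<tau>) - (\<Sum>\<sigma>\<in>simplices_dim K n. weight \<sigma> * angle z \<sigma>))
    + lam * (\<Sum>\<sigma>\<in>simplices_dim K n. weight \<sigma> * svol z \<sigma>)"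

lemma regge_eq:
  "regge n K z = (\<Sum>\<tau>\<in>simplices_dim K (n - 2). bone z \<tau>) - (\<Sum>\<sigma>\<in>simplices_dim K n. angle z \<sigma>)"
proof -
  have "regge n K z = (\<Sum>\<tau>\<in>simplices_dim K (n - 2). bone z \<tau>)
      - (\<Sum>\<tau>\<in>simplices_dim K (n - 2). \<Sum>\<sigma> | \<sigma> \<in> simplices_dim K n \<and> \<tau> \<subseteq> \<sigma>. dihedral n z \<tau> \<sigma> * svol z \<tau>)"
    unfolding regge_def bone_def by (simp add: left_diff_distrib sum_subtractf sum_distrib_right)
  also have "(\<Sum>\<tau>\<in>simplices_dim K (n - 2). \<Sum>\<sigma> | \<sigma> \<in> simplices_dim K n \<and> \<tau> \<subseteq> \<sigma>. dihedral n z \<tau> \<sigma> * svol z \<tau>)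
      = (\<Sum>\<sigma>\<in>simplices_dim K n. angle z \<sigma>)"
    unfolding angle_def by (rule sum.swap_restrict) (auto simp: finite_simplices)
  finally show ?thesis .
qed

lemma svol_refl: "s \<in> simplices_dim K k \<Longrightarrow> svol (refl_metric \<theta> z) s = svol z (\<theta> ` s)"
  by (rule svol_refl_metric) (auto simp: simplices_dim_def inj_theta K_simplex)

lemma bone_refl: "\<tau> \<in> simplices_dim K k \<Longrightarrow> bone (refl_metric \<theta> z) \<tau> = bone z (\<theta> ` \<tau>)"
  by (simp add: bone_def svol_refl) (simp add: image_boundary simplices_dim_def)

lemma angle_refl:
  assumes \<sigma>: "\<sigma> \<in> simplices_dim K n" and pos: "\<And>\<sigma>. \<sigma> \<in> K \<Longrightarrow> gram_pos z \<sigma>"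
  shows "angle (refl_metric \<theta> z) \<sigma> = angle z (\<theta> ` \<sigma>)"
proof -
  have \<sigma>K: "\<sigma> \<in> K" "card \<sigma> = n + 1" using \<sigma> by (auto simp: simplices_dim_def)
  have "angle (refl_metric \<theta> z) \<sigma>
    = (\<Sum>\<tau> | \<tau> \<in> simplices_dim K (n - 2) \<and> \<tau> \<subseteq> \<sigma>. dihedral n z (\<theta> ` \<tau>) (\<theta> ` \<sigma>) * svol z (\<theta> ` \<tau>))"
    unfolding angle_def
  proof (rule sum.cong[OF refl])
    fix \<tau> assume "\<tau> \<in> {\<tau> \<in> simplices_dim K (n - 2). \<tau> \<subseteq> \<sigma>}"
    then have \<tau>: "\<tau> \<in> simplices_dim K (n - 2)" "\<tau> \<subseteq> \<sigma>" by auto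
    have "dihedral n (refl_metric \<theta> z) \<tau> \<sigma> = dihedral n z (\<theta> ` \<tau>) (\<theta> ` \<sigma>)"
      by (rule dihedral_refl_metric)
        (use \<sigma>K \<tau> n in \<open>auto simp: inj_theta K_simplex simplices_dim_def pos image_K\<close>)
    then show "dihedral n (refl_metric \<theta> z) \<tau> \<sigma> * svol (refl_metric \<theta> z) \<tau>
      = dihedral n z (\<theta> ` \<tau>) (\<theta> ` \<sigma>) * svol z (\<theta> ` \<tau>)" by (simp add: svol_refl[OF \<tau>(1)])
  qed
  also have "\<dots> = angle z (\<theta> ` \<sigma>)"
    unfolding angle_def using sum.reindex_bij_betw[OF bij_faces[OF \<sigma>K(1)]] by simp
  finally show ?thesis .
qed

text \<open>Each of the three sums splits separately. Positivity enters through the angles, whose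
  equivariance relies on realizations.\<close>

lemma hilbert_action_split:
  assumes pos: "\<And>\<sigma>. \<sigma> \<in> K \<Longrightarrow> gram_pos z \<sigma>"
  shows "hilbert_action gam lam n K z = half_action gam lam z + half_action gam lam (refl_metric \<theta> z)"
  unfolding hilbert_action_def half_action_def regge_eq total_volume_def
  by (subst sum_simplices_split[of _ "bone (refl_metric \<theta> z)" "bone z"], simp add: bone_refl,
      subst sum_simplices_split[of _ "angle (refl_metric \<theta> z)" "angle z"], simp add: angle_refl pos,
      subst sum_simplices_split[of _ "svol (refl_metric \<theta> z)" "svol z"], simp add: svol_refl)
    (simp add: algebra_simps)

section \<open>Locality in the edges of \<open>Kp\<close>\<close>

lemma edges_K: "edges K = edges Kp \<union> edges Km"
  using K_eq by (auto simp: edges_def simplices_dim_def)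

lemma finite_edges: "finite (edges K)"
  by (simp add: edges_def finite_simplices)

lemma zz_restrict:
  assumes "s \<in> Kp" "u \<in> s" "w \<in> s"
  shows "zz (restrict z (edges Kp)) u w = zz z u w"
proof (cases "u = w")
  case False
  have "{u, w} \<in> Kp" using assms by (intro Kp_face[OF assms(1)]) auto
  then have "{u, w} \<in> edges Kp" using False by (simp add: edges_def simplices_dim_def)
  then show ?thesis by (simp add: zz_def)
qed simp

lemma Kp_simplex: "s \<in> Kp \<Longrightarrow> finite s" "s \<in> Kp \<Longrightarrow> s \<noteq> {}"
  using Kp_sub K_simplex by blast+

lemma detA_restrict: "s \<in> Kp \<Longrightarrow> detA (restrict z (edges Kp)) s = detA z s"
  by (rule detA_cong) (auto simp: Kp_simplex zz_restrict)

lemma svol_restrict: "s \<in> Kp \<Longrightarrow> svol (restrict z (edges Kp)) s = svol z s"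
  by (simp add: svol_def detA_restrict)

text \<open>Simplices outside \<open>Kp\<close> have weight 0, and those inside have all their faces
  in \<open>Kp\<close>, so only edges of \<open>Kp\<close> are read. The boundary factor in
  \<open>bone\<close> is combinatorial and does not see the metric.\<close>

lemma half_action_restrict: "half_action gam lam (restrict z (edges Kp)) = half_action gam lam z"
proof -
  let ?z = "restrict z (edges Kp)"
  have bone: "weight s * bone ?z s = weight s * bone z s" for s
    by (simp add: bone_def svol_restrict weight_def)
  have vol: "weight s * svol ?z s = weight s * svol z s" for s
    by (simp add: svol_restrict weight_def)
  have angle: "weight s * angle ?z s = weight s * angle z s" for s
  proof (cases "s \<in> Kp")
    case True
    have "angle ?z s = angle z s"
      unfolding angle_def
    proof (rule sum.cong[OF refl])
      fix \<tau> assume "\<tau> \<in> {\<tau> \<in> simplices_dim K (n - 2). \<tau> \<subseteq> s}"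
      then have "\<tau> \<in> Kp" using Kp_face[OF True, of \<tau>] K_simplex(2) by (auto simp: simplices_dim_def)
      then show "dihedral n ?z \<tau> s * svol ?z \<tau> = dihedral n z \<tau> s * svol z \<tau>"
        using dihedral_cong[of s ?z z n \<tau>] zz_restrict[OF True] by (simp add: svol_restrict)
    qed
    then show ?thesis by simp
  qed (simp add: weight_def)
  show ?thesis by (simp add: half_action_def bone vol angle)
qed

section \<open>Factorization of the cut-off and of the integrand\<close>

lemma bij_edges: "bij_betw ((`) \<theta>) (edges Kp) (edges Km)"
proof (rule bij_betw_byWitness[where f' = "(`) \<theta>"])
  have "s \<in> K" if "s \<in> Kp \<or> s \<in> Km" for s using that K_eq by auto
  then show "\<forall>e\<in>edges Kp. \<theta> ` \<theta> ` e = e" "\<forall>e\<in>edges Km. \<theta> ` \<theta> ` e = e"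
    "(`) \<theta> ` edges Kp \<subseteq> edges Km" "(`) \<theta> ` edges Km \<subseteq> edges Kp"
    by (auto simp: edges_def simplices_dim_def image_twice image_Kp image_Km card_image_K)
qed

text \<open>Free of the extensionality built into \<open>cutoff\<close>, so that it also applies to
  \<open>refl_metric \<theta> z\<close>, which need not be extensional.\<close>

definition half_cutoff :: "real \<Rightarrow> ('v set \<Rightarrow> real) \<Rightarrow> bool" where
  "half_cutoff \<kappa> y \<longleftrightarrow> (\<forall>e\<in>edges Kp. 0 < y e)
    \<and> (\<forall>\<sigma>\<in>Kp. 2 \<le> card \<sigma> \<and> card \<sigma> \<le> n + 1 \<longrightarrow> 1 / \<kappa> \<le> detA y \<sigma>) \<and> edge_norm Kp y \<le> \<kappa>"

lemma edge_norm_refl: "edge_norm Kp (refl_metric \<theta> z) = edge_norm Km z"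
  unfolding edge_norm_def refl_metric_def
  using sum.reindex_bij_betw[OF bij_edges, of "\<lambda>e. (z e)^2"] by simp

lemma half_cutoff_restrict: "half_cutoff \<kappa> (restrict z (edges Kp)) \<longleftrightarrow> half_cutoff \<kappa> z"
  by (simp add: half_cutoff_def detA_restrict edge_norm_def)

text \<open>By equivariance, the conditions on \<open>Kp\<close> for the reflected metric are the
  conditions on \<open>Km\<close> for \<open>z\<close>.\<close>

lemma cutoff_split:
  assumes "z \<in> edges K \<rightarrow>\<^sub>E UNIV"
  shows "z \<in> cutoff n K Kp Km \<kappa> \<longleftrightarrow> half_cutoff \<kappa> z \<and> half_cutoff \<kappa> (refl_metric \<theta> z)"
proof -
  have det: "detA (refl_metric \<theta> z) s = detA z (\<theta> ` s)" if "s \<in> Kp" for s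
    using that Kp_sub by (intro detA_refl_metric) (auto simp: inj_theta Kp_simplex)
  have card: "card (\<theta> ` s) = card s" if "s \<in> Kp" for s
    using that Kp_sub card_image_K by blast
  have "(\<forall>e\<in>edges Kp. 0 < refl_metric \<theta> z e) \<longleftrightarrow> (\<forall>e\<in>edges Km. 0 < z e)"
    unfolding bij_betw_imp_surj_on[OF bij_edges, symmetric] by (simp add: refl_metric_def)
  moreover have "(\<forall>\<sigma>\<in>Kp. 2 \<le> card \<sigma> \<and> card \<sigma> \<le> n + 1 \<longrightarrow> 1 / \<kappa> \<le> detA (refl_metric \<theta> z) \<sigma>)
      \<longleftrightarrow> (\<forall>\<sigma>\<in>Km. 2 \<le> card \<sigma> \<and> card \<sigma> \<le> n + 1 \<longrightarrow> 1 / \<kappa> \<le> detA z \<sigma>)"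
    unfolding Km_eq by (simp add: det card)
  moreover have "z \<in> cutoff n K Kp Km \<kappa> \<longleftrightarrow> (\<forall>e\<in>edges Kp \<union> edges Km. 0 < z e)
      \<and> (\<forall>\<sigma>\<in>Kp \<union> Km. 2 \<le> card \<sigma> \<and> card \<sigma> \<le> n + 1 \<longrightarrow> 1 / \<kappa> \<le> detA z \<sigma>)
      \<and> edge_norm Kp z \<le> \<kappa> \<and> edge_norm Km z \<le> \<kappa>"
    using assms unfolding cutoff_def edges_K[symmetric] K_eq[symmetric] by simp
  ultimately show ?thesis
    unfolding half_cutoff_def edge_norm_refl ball_Un by argo
qed

text \<open>Every simplex lies in a top simplex and so has at most \<open>n + 1\<close> vertices;
  the lower bound of the cut-off thus reaches all faces.\<close>

lemma cutoff_gram_pos: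
  assumes z: "z \<in> cutoff n K Kp Km \<kappa>" and \<kappa>: "0 < \<kappa>" and \<sigma>: "\<sigma> \<in> K"
  shows "gram_pos z \<sigma>"
  unfolding gram_pos_def
proof (intro allI impI)
  fix \<tau> assume \<tau>: "\<tau> \<subseteq> \<sigma>" "2 \<le> card \<tau>"
  have "\<tau> \<noteq> {}" using \<tau> by auto
  then have \<tau>K: "\<tau> \<in> K" using complex \<sigma> \<tau> unfolding simplicial_complex_def by blast
  obtain t where t: "t \<in> simplices_dim K n" "\<tau> \<subseteq> t"
    using pseudo \<tau>K unfolding pseudomanifold_def by blast
  have "card \<tau> \<le> n + 1"
    using card_mono[OF _ t(2)] t(1) K_simplex(1) by (auto simp: simplices_dim_def)
  then have "1 / \<kappa> \<le> detA z \<tau>" using z \<tau>K \<tau> by (simp add: cutoff_def)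
  then show "0 < detA z \<tau>" using \<kappa> by (meson less_le_trans zero_less_divide_1_iff)
qed

text \<open>Extension by 0 absorbs the cut-off, which turns the set integral into one over the full
  product space.\<close>

definition half_integrand ::
  "real \<Rightarrow> real \<Rightarrow> real \<Rightarrow> (('v set \<Rightarrow> real) \<Rightarrow> complex) \<Rightarrow> ('v set \<Rightarrow> real) \<Rightarrow> complex" where
  "half_integrand gam lam \<kappa> f y =
    (if half_cutoff \<kappa> y then f y * complex_of_real (exp (- half_action gam lam y)) else 0)"

text \<open>On the cut-off the exponential of the split action factors; off it, one of the two half
  cut-offs fails and both sides vanish.\<close>

lemma integrand_split:
  fixes gam lam \<kappa> :: real and f :: "('v set \<Rightarrow> real) \<Rightarrow> complex"
  assumes \<kappa>: "0 < \<kappa>" and z: "z \<in> edges K \<rightarrow>\<^sub>E UNIV"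
  defines "F \<equiv> half_integrand gam lam \<kappa> f"
  shows "indicator (cutoff n K Kp Km \<kappa>) z *\<^sub>R
      (cnj (f (proj_plus Kp (refl_metric \<theta> z))) * f (proj_plus Kp z)
        * complex_of_real (exp (- hilbert_action gam lam n K z)))
    = cnj (F (restrict (refl_metric \<theta> z) (edges Kp))) * F (restrict z (edges Kp))"
proof (cases "z \<in> cutoff n K Kp Km \<kappa>")
  case True
  have "half_cutoff \<kappa> z" "half_cutoff \<kappa> (refl_metric \<theta> z)"
    using True cutoff_split[OF z] by auto
  then show ?thesis
    using True by (simp add: F_def half_integrand_def half_cutoff_restrict half_action_restrict proj_plus_def
      hilbert_action_split[OF cutoff_gram_pos[OF True \<kappa>]] exp_add exp_diff exp_minus field_simps)
next
  case False
  then show ?thesis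
    using cutoff_split[OF z, of \<kappa>] by (auto simp: F_def half_integrand_def half_cutoff_restrict)
qed

lemma reflected_integral_nonneg:
  assumes \<kappa>: "0 < \<kappa>"
  shows "(LINT z:cutoff n K Kp Km \<kappa>|edge_measure K.
      cnj (f (proj_plus Kp (refl_metric \<theta> z))) * f (proj_plus Kp z)
      * complex_of_real (exp (- hilbert_action gam lam n K z))) \<in> \<real>\<^sub>\<ge>\<^sub>0" (is "?I \<in> _")
proof -
  \<comment> \<open>The shared edges are fixed by \<theta>; the edges of exactly one side are
    exchanged with those of the other.\<close>
  let ?E\<^sub>0 = "edges Kp \<inter> edges Km" and ?A = "edges Kp - edges Km" and ?B = "edges Km - edges Kp"
  define F where "F = half_integrand gam lam \<kappa> f"
  have E: "edges K = ?E\<^sub>0 \<union> (?A \<union> ?B)" "?E\<^sub>0 \<union> ?A = edges Kp" using edges_K by auto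
  have fixed: "\<theta> ` e = e" if "e \<in> ?E\<^sub>0" for e
    using that image_fixed by (auto simp: edges_def simplices_dim_def)
  have eK: "e \<in> K" if "e \<in> edges Kp \<or> e \<in> edges Km" for e
    using that K_eq by (auto simp: edges_def simplices_dim_def)
  have im: "e \<in> edges Kp \<Longrightarrow> \<theta> ` e \<in> edges Kp \<Longrightarrow> e \<in> edges Km"
    "e \<in> edges Km \<Longrightarrow> \<theta> ` e \<in> edges Km \<Longrightarrow> e \<in> edges Kp" for e
    using eK[of e] by (auto simp: edges_def simplices_dim_def image_Kp image_Km card_image_K)
  have disj: "?E\<^sub>0 \<inter> ?A = {}" "?E\<^sub>0 \<inter> ?B = {}" "?A \<inter> ?B = {}" by auto
  have bij: "bij_betw ((`) \<theta>) ?A ?B"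
  proof (rule bij_betw_byWitness[where f' = "(`) \<theta>"])
    show "(`) \<theta> ` ?A \<subseteq> ?B" "(`) \<theta> ` ?B \<subseteq> ?A"
      using im bij_edges image_twice eK by (auto simp: bij_betw_def edges_def simplices_dim_def image_Kp image_Km card_image_K)
  qed (use image_twice eK in auto)
  have "?I = (\<integral>z. cnj (F (restrict (refl_metric \<theta> z) (edges Kp))) * F (restrict z (edges Kp)) \<partial>edge_measure K)"
    unfolding set_lebesgue_integral_def F_def
    by (rule Bochner_Integration.integral_cong[OF refl], rule integrand_split[OF \<kappa>])
      (simp add: edge_measure_def space_PiM)
  also have "\<dots> \<in> \<real>\<^sub>\<ge>\<^sub>0"
    using reflection_positivity[OF _ _ _ disj bij fixed, of F] finite_edges edges_K
    unfolding E(2) E(1)[symmetric] by (simp add: edge_measure_def refl_metric_def)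
  finally show ?thesis .
qed

end

theorem theorem4p6:
  fixes n :: nat and K Kp Km :: "'v set set" and \<theta> :: "'v \<Rightarrow> 'v"
    and gam lam \<kappa> :: real and f :: "('v set \<Rightarrow> real) \<Rightarrow> complex"
  assumes "n \<ge> 3"
    and "pseudomanifold n K"
    and "reflection n K \<theta> Kp Km"
    and "\<kappa> > 0"
    and "partition_fn gam lam n K Kp Km \<kappa> > 0"
    and "continuous_on (proj_plus Kp ` cutoff n K Kp Km \<kappa>) f"
  shows "let I = (1 / complex_of_real (partition_fn gam lam n K Kp Km \<kappa>)) *
              (LINT z:cutoff n K Kp Km \<kappa>|edge_measure K.
                  cnj (f (proj_plus Kp (refl_metric \<theta> z))) * f (proj_plus Kp z)
                  * complex_of_real (exp (- hilbert_action gam lam n K z)))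
         in Im I = 0 \<and> Re I \<ge> 0"
proof -
  interpret reflected_complex n K Kp Km \<theta>
    using assms by unfold_locales
  let ?Z = "partition_fn gam lam n K Kp Km \<kappa>"
  \<comment> \<open>Membership in \<open>\<real>\<^sub>\<ge>\<^sub>0\<close> expresses vanishing
    imaginary part and nonnegative real part at once and is closed under products.\<close>
  have Z: "1 / complex_of_real ?Z \<in> \<real>\<^sub>\<ge>\<^sub>0"
    using nonneg_Reals_of_real_iff[of "1 / ?Z", where 'a = complex] assms(5) by simp
  have nonneg: "let I = x in Im I = 0 \<and> Re I \<ge> 0" if "x \<in> \<real>\<^sub>\<ge>\<^sub>0" for x
    using that by (simp add: complex_nonneg_Reals_iff)
  show ?thesis
    by (rule nonneg, rule nonneg_Reals_mult_I[OF Z reflected_integral_nonneg[OF assms(4)]])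
qed

end
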